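(* Consider the linear system: find $\phi\in H^1(\Omega)$ such that $$(L\phi,\psi)=(b,\psi)\qquad\text{for all }\psi\in H^1(\Omega),$$ where $$(L\phi,\psi)=\frac1{M\delta t}(\phi,\psi)+\epsilon^2(\nabla\phi,\nabla\psi)+\frac12(H^n\phi,H^n\psi),\qquad b=\frac1{M\delta t}\phi^n-H^nU^n+\frac12H^nH^n\phi^n .$$ This linear system admits a unique solution $\phi\in H^1(\Omega)$. Furthermore, the bilinear form $(L\phi,\psi)$ is symmetric positive definite.
   Context: $\Omega\subseteq\mathbb R^d$ ($d=2,3$) is the spatial domain and $(\cdot,\cdot)$ is the $L^2(\Omega)$ inner product. $M>0$ (mobility), $\epsilon>0$ (interface parameter) and $\delta t>0$ (time step size) are constants. $F$ is a nonlinear bulk potential bounded from below on its domain of definition, $F(x)>-A$ for some positive constant $A$; $B>A$ is a constant, $f=F'$, and $H(\phi)=f(\phi)/\sqrt{F(\phi)+B}$. The system is the weak form of one time step of the scheme $$\frac{\phi^{n+1}-\phi^n}{\delta t}+M\big(-\epsilon^2\Delta\phi^{n+1}+H^nU^{n+1}\big)=0,\qquad U^{n+1}-U^n=\tfrac12H^n(\phi^{n+1}-\phi^n),\qquad H^n=H(\phi^n),$$ for the Allen-Cahn equation (with $\phi^{n+1}$ periodic, or $\partial_{\boldsymbol n}\phi^{n+1}|_{\partial\Omega}=0$), after eliminating $U^{n+1}$; here $\phi$ stands for $\phi^{n+1}$, and $\phi^n,U^n$ are the known values from the previous time step. Positive definite means $(L\phi,\phi)\ge0$ for $\phi\in H^1(\Omega)$,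 with equality if and only if $\phi\equiv0$. *)

theory Defs
  imports "HOL-Analysis.Analysis"
begin

definition partial_deriv :: "'d \<Rightarrow> (real^'d \<Rightarrow> real) \<Rightarrow> real^'d::finite \<Rightarrow> real" where
  "partial_deriv i f x = frechet_derivative f (at x) (axis i 1)"

primrec C_k :: "nat \<Rightarrow> (real^'d::finite \<Rightarrow> real) \<Rightarrow> bool" where
  "C_k 0 f \<longleftrightarrow> continuous_on UNIV f"
| "C_k (Suc k) f \<longleftrightarrow> f differentiable_on UNIV \<and> (\<forall>i. C_k k (partial_deriv i f))"

definition C_infinity :: "(real^'d::finite \<Rightarrow> real) set" where
  "C_infinity = {f. \<forall>k. C_k k f}"

definition test_functions :: "(real^'d::finite) set \<Rightarrow> (real^'d \<Rightarrow> real) set" where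
  "test_functions \<Omega> =
     {\<eta> \<in> C_infinity. compact (closure {x. \<eta> x \<noteq> 0}) \<and> closure {x. \<eta> x \<noteq> 0} \<subseteq> \<Omega>}"

definition periodic_smooth :: "real^'d::finite \<Rightarrow> real^'d \<Rightarrow> (real^'d \<Rightarrow> real) set" where
  "periodic_smooth a b =
     {\<eta> \<in> C_infinity. \<forall>x i. \<eta> (x + (b $ i - a $ i) *\<^sub>R axis i 1) = \<eta> x}"

text \<open>
  Elements of these spaces are functions, not equivalence classes, so equality of elements
  is equality almost everywhere on the domain. Values outside the domain are irrelevant.
\<close>

definition L2 :: "(real^'d::finite) set \<Rightarrow> (real^'d \<Rightarrow> 'b::euclidean_space) set" where
  "L2 \<Omega> = {u. set_borel_measurable lebesgue \<Omega> u \<and>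
               set_integrable lebesgue \<Omega> (\<lambda>x. (norm (u x))\<^sup>2)}"

definition L2_inner ::
    "(real^'d::finite) set \<Rightarrow> (real^'d \<Rightarrow> 'b::euclidean_space) \<Rightarrow> (real^'d \<Rightarrow> 'b) \<Rightarrow> real" where
  "L2_inner \<Omega> u v = (LINT x:\<Omega>|lebesgue. u x \<bullet> v x)"

definition is_weak_grad ::
    "(real^'d::finite) set \<Rightarrow> (real^'d \<Rightarrow> real) \<Rightarrow> (real^'d \<Rightarrow> real^'d) \<Rightarrow> bool" where
  "is_weak_grad \<Omega> u g \<longleftrightarrow>
     (\<forall>\<eta>\<in>test_functions \<Omega>. \<forall>i.
        L2_inner \<Omega> u (partial_deriv i \<eta>) = - L2_inner \<Omega> (\<lambda>x. g x $ i) \<eta>)"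

definition H1 :: "(real^'d::finite) set \<Rightarrow> (real^'d \<Rightarrow> real) set" where
  "H1 \<Omega> = {u \<in> L2 \<Omega>. \<exists>g\<in>L2 \<Omega>. is_weak_grad \<Omega> u g}"

text \<open>The weak gradient is determined only up to null sets; a representative is chosen.\<close>

definition weak_grad ::
    "(real^'d::finite) set \<Rightarrow> (real^'d \<Rightarrow> real) \<Rightarrow> real^'d \<Rightarrow> real^'d" where
  "weak_grad \<Omega> u = (SOME g. g \<in> L2 \<Omega> \<and> is_weak_grad \<Omega> u g)"

text \<open>
  The periodic functions in $H^1$ of the cell with corners \<open>a\<close> and \<open>b\<close>: integration by parts
  against smooth periodic functions produces no boundary terms, which says that the traces
  on opposite faces coincide.
\<close>

definition H1_per :: "real^'d::finite \<Rightarrow> real^'d \<Rightarrow> (real^'d \<Rightarrow> real) set" where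
  "H1_per a b =
     {u \<in> H1 (box a b). \<forall>\<eta>\<in>periodic_smooth a b. \<forall>i.
        L2_inner (box a b) u (partial_deriv i \<eta>) =
          - L2_inner (box a b) (\<lambda>x. weak_grad (box a b) u x $ i) \<eta>}"

definition bilinear_form_on :: "('a \<Rightarrow> real) set \<Rightarrow> (('a \<Rightarrow> real) \<Rightarrow> ('a \<Rightarrow> real) \<Rightarrow> real) \<Rightarrow> bool" where
  "bilinear_form_on V a \<longleftrightarrow>
     (\<forall>u\<in>V. \<forall>v\<in>V. \<forall>w\<in>V. \<forall>c d.
        a (\<lambda>x. c * u x + d * v x) w = c * a u w + d * a v w \<and>
        a w (\<lambda>x. c * u x + d * v x) = c * a w u + d * a w v)"

definition symmetric_form_on :: "('a \<Rightarrow> real) set \<Rightarrow> (('a \<Rightarrow> real) \<Rightarrow> ('a \<Rightarrow> real) \<Rightarrow> real) \<Rightarrow> bool" where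
  "symmetric_form_on V a \<longleftrightarrow> (\<forall>u\<in>V. \<forall>v\<in>V. a u v = a v u)"

definition positive_definite_on ::
    "(real^'d::finite) set \<Rightarrow> (real^'d \<Rightarrow> real) set \<Rightarrow>
     ((real^'d \<Rightarrow> real) \<Rightarrow> (real^'d \<Rightarrow> real) \<Rightarrow> real) \<Rightarrow> bool" where
  "positive_definite_on \<Omega> V a \<longleftrightarrow>
     (\<forall>u\<in>V. a u u \<ge> 0 \<and> (a u u = 0 \<longleftrightarrow> (AE x\<in>\<Omega> in lebesgue. u x = 0)))"

definition H_fun :: "(real \<Rightarrow> real) \<Rightarrow> (real \<Rightarrow> real) \<Rightarrow> real \<Rightarrow> real \<Rightarrow> real" where
  "H_fun F f B s = f s / sqrt (F s + B)"

definition L_form ::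
    "(real^'d::finite) set \<Rightarrow> real \<Rightarrow> real \<Rightarrow> real \<Rightarrow> (real^'d \<Rightarrow> real) \<Rightarrow>
     (real^'d \<Rightarrow> real) \<Rightarrow> (real^'d \<Rightarrow> real) \<Rightarrow> real" where
  "L_form \<Omega> M \<epsilon> \<delta>t H\<^sub>n \<phi> \<psi> =
     1 / (M * \<delta>t) * L2_inner \<Omega> \<phi> \<psi>
     + \<epsilon>\<^sup>2 * L2_inner \<Omega> (weak_grad \<Omega> \<phi>) (weak_grad \<Omega> \<psi>)
     + 1 / 2 * L2_inner \<Omega> (\<lambda>x. H\<^sub>n x * \<phi> x) (\<lambda>x. H\<^sub>n x * \<psi> x)"

definition b_rhs ::
    "real \<Rightarrow> real \<Rightarrow> ('a \<Rightarrow> real) \<Rightarrow> ('a \<Rightarrow> real) \<Rightarrow> ('a \<Rightarrow> real) \<Rightarrow> 'a \<Rightarrow> real" where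
  "b_rhs M \<delta>t H\<^sub>n \<phi>\<^sub>n U\<^sub>n x =
     1 / (M * \<delta>t) * \<phi>\<^sub>n x - H\<^sub>n x * U\<^sub>n x + 1 / 2 * H\<^sub>n x * H\<^sub>n x * \<phi>\<^sub>n x"

definition is_solution ::
    "(real^'d::finite) set \<Rightarrow> (real^'d \<Rightarrow> real) set \<Rightarrow>
     ((real^'d \<Rightarrow> real) \<Rightarrow> (real^'d \<Rightarrow> real) \<Rightarrow> real) \<Rightarrow> (real^'d \<Rightarrow> real) \<Rightarrow> (real^'d \<Rightarrow> real) \<Rightarrow> bool" where
  "is_solution \<Omega> V a b \<phi> \<longleftrightarrow> \<phi> \<in> V \<and> (\<forall>\<psi>\<in>V. a \<phi> \<psi> = L2_inner \<Omega> b \<psi>)"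

end

theory Submission
  imports Defs "HOL-Computational_Algebra.Polynomial"
begin

text \<open>
  The form is an inner product in disguise. Put \<open>c = 1 / sqrt (M \<delta>t)\<close>, \<open>k = 1 / sqrt 2\<close> and send
  \<open>\<phi>\<close> to its weighted graph \<open>graph \<phi> = (c \<phi>, \<epsilon> \<nabla>\<phi>, k H\<^sub>n \<phi>)\<close>, a square integrable function with
  values in \<open>\<real> \<times> \<real>\<^sup>d \<times> \<real>\<close>. Then \<open>(L \<phi>, \<psi>)\<close> is the \<open>L\<^sup>2\<close> inner product of \<open>graph \<phi>\<close> and
  \<open>graph \<psi>\<close>, and \<open>(b, \<psi>)\<close> is that of \<open>G\<close> and \<open>graph \<psi>\<close>, where
  \<open>G = (c \<phi>\<^sub>n, 0, k H\<^sub>n \<phi>\<^sub>n - U\<^sub>n / k)\<close>. Hence \<open>\<phi>\<close> solves the system exactly when \<open>graph \<phi>\<close> is the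
  orthogonal projection of \<open>G\<close> to the range of \<open>graph\<close>. Stating the right-hand side through
  \<open>G\<close> is what makes it a bounded functional of \<open>\<psi>\<close>: the products \<open>H\<^sub>n U\<^sub>n\<close> and \<open>H\<^sub>n H\<^sub>n \<phi>\<^sub>n\<close> need
  not be square integrable themselves. Symmetry is clear, and definiteness and uniqueness hold
  because the first component of the graph determines \<open>\<phi>\<close>.

  Three facts carry the argument. The projection to a closed subspace exists
  (\<open>projection_exists\<close>), which rests on the completeness of \<open>L\<^sup>2\<close> (\<open>sq_integrable_complete\<close>). The
  range of \<open>graph\<close> is closed (\<open>graph_range_closed\<close>): integration by parts passes to \<open>L\<^sup>2\<close> limits, and
  the third component is identified along a subsequence that converges almost everywhere, which
  works for unbounded \<open>H\<^sub>n\<close> as well. The weak gradient is unique almost everywhere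
  (\<open>weak_grad_AE_unique\<close>), so that the chosen representative is linear in \<open>\<phi>\<close> up to null sets;
  this is the fundamental lemma of the calculus of variations (\<open>fundamental_lemma\<close>), for which
  explicit smooth functions that increase to the indicator of a box are constructed.
\<close>

section \<open>Square integrable functions\<close>

definition sq_integrable :: "'a measure \<Rightarrow> ('a \<Rightarrow> 'b::euclidean_space) set" where
  "sq_integrable N = {u \<in> borel_measurable N. integrable N (\<lambda>x. (norm (u x))\<^sup>2)}"

definition int_inner :: "'a measure \<Rightarrow> ('a \<Rightarrow> 'b::euclidean_space) \<Rightarrow> ('a \<Rightarrow> 'b) \<Rightarrow> real" where
  "int_inner N u v = (\<integral>x. u x \<bullet> v x \<partial>N)"

lemma sq_integrable_measurable: "u \<in> sq_integrable N \<Longrightarrow> u \<in> borel_measurable N"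
  by (simp add: sq_integrable_def)

lemma sq_integrable_bound:
  assumes "u \<in> borel_measurable N" "integrable N g" "AE x in N. (norm (u x))\<^sup>2 \<le> g x"
  shows "u \<in> sq_integrable N"
  unfolding sq_integrable_def
proof (intro CollectI conjI)
  show "integrable N (\<lambda>x. (norm (u x))\<^sup>2)"
    by (rule Bochner_Integration.integrable_bound[OF assms(2)]) (use assms in auto)
qed (use assms in auto)

lemma sq_integrable_inner_integrable:
  assumes "u \<in> sq_integrable N" "v \<in> sq_integrable N"
  shows "integrable N (\<lambda>x. u x \<bullet> v x)"
proof (rule Bochner_Integration.integrable_bound)
  show "integrable N (\<lambda>x. (norm (u x))\<^sup>2 + (norm (v x))\<^sup>2)"
    using assms by (auto simp: sq_integrable_def)
  show "(\<lambda>x. u x \<bullet> v x) \<in> borel_measurable N"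
    using assms by (auto simp: sq_integrable_def)
  have "norm (u x \<bullet> v x) \<le> norm ((norm (u x))\<^sup>2 + (norm (v x))\<^sup>2)" for x
  proof -
    have "\<bar>u x \<bullet> v x\<bar> \<le> norm (u x) * norm (v x)"
      by (rule Cauchy_Schwarz_ineq2)
    also have "\<dots> \<le> (norm (u x))\<^sup>2 + (norm (v x))\<^sup>2"
    proof -
      have "0 \<le> (norm (u x) - norm (v x))\<^sup>2" "0 \<le> norm (u x) * norm (v x)" by auto
      then show ?thesis unfolding power2_diff by linarith
    qed
    finally show ?thesis by simp
  qed
  then show "AE x in N. norm (u x \<bullet> v x) \<le> norm ((norm (u x))\<^sup>2 + (norm (v x))\<^sup>2)"
    by simp
qed

lemma sq_integrable_lincomb:
  assumes "u \<in> sq_integrable N" "v \<in> sq_integrable N"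
  shows "(\<lambda>x. c *\<^sub>R u x + d *\<^sub>R v x) \<in> sq_integrable N"
proof -
  have "integrable N (\<lambda>x. c\<^sup>2 * (norm (u x))\<^sup>2 + 2 * c * d * (u x \<bullet> v x) + d\<^sup>2 * (norm (v x))\<^sup>2)"
    using assms sq_integrable_inner_integrable[OF assms] by (auto simp: sq_integrable_def)
  moreover have "(norm (c *\<^sub>R u x + d *\<^sub>R v x))\<^sup>2 =
      c\<^sup>2 * (norm (u x))\<^sup>2 + 2 * c * d * (u x \<bullet> v x) + d\<^sup>2 * (norm (v x))\<^sup>2" for x
    unfolding power2_norm_eq_inner
    by (simp add: inner_add inner_commute power2_eq_square algebra_simps)
  ultimately show ?thesis
    using assms by (auto simp: sq_integrable_def)
qed

lemma sq_integrable_diff: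
  assumes "u \<in> sq_integrable N" "v \<in> sq_integrable N"
  shows "(\<lambda>x. u x - v x) \<in> sq_integrable N"
  using sq_integrable_lincomb[OF assms, of 1 "-1"] by simp

lemma sq_integrable_scale: "u \<in> sq_integrable N \<Longrightarrow> (\<lambda>x. c *\<^sub>R u x) \<in> sq_integrable N"
  using sq_integrable_lincomb[of u N u c 0] by simp

lemma int_inner_commute: "int_inner N u v = int_inner N v u"
  by (simp add: int_inner_def inner_commute)

lemma int_inner_lincomb:
  assumes "u \<in> sq_integrable N" "v \<in> sq_integrable N" "w \<in> sq_integrable N"
  shows "int_inner N (\<lambda>x. c *\<^sub>R u x + d *\<^sub>R v x) w = c * int_inner N u w + d * int_inner N v w"
  using sq_integrable_inner_integrable[OF assms(1,3)] sq_integrable_inner_integrable[OF assms(2,3)]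
  by (simp add: int_inner_def inner_add_left)

lemma int_inner_diff:
  assumes "u \<in> sq_integrable N" "v \<in> sq_integrable N" "w \<in> sq_integrable N"
  shows "int_inner N (\<lambda>x. u x - v x) w = int_inner N u w - int_inner N v w"
  using int_inner_lincomb[OF assms, of 1 "-1"] by simp

lemma int_inner_self_nonneg: "0 \<le> int_inner N u u"
  by (simp add: int_inner_def)

lemma int_inner_self_eq_0_iff:
  assumes "u \<in> sq_integrable N"
  shows "int_inner N u u = 0 \<longleftrightarrow> (AE x in N. u x = 0)"
  unfolding int_inner_def
  by (subst integral_nonneg_eq_0_iff_AE) (use sq_integrable_inner_integrable[OF assms assms] in auto)

lemma int_inner_cong_AE:
  assumes "u \<in> borel_measurable N" "u' \<in> borel_measurable N" "v \<in> borel_measurable N" "v' \<in> borel_measurable N"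
    "AE x in N. u x = u' x" "AE x in N. v x = v' x"
  shows "int_inner N u v = int_inner N u' v'"
  unfolding int_inner_def by (rule integral_cong_AE) (use assms in auto)

lemma int_inner_self_lincomb:
  assumes "u \<in> sq_integrable N" "v \<in> sq_integrable N"
  shows "int_inner N (\<lambda>x. c *\<^sub>R u x + d *\<^sub>R v x) (\<lambda>x. c *\<^sub>R u x + d *\<^sub>R v x) =
    c\<^sup>2 * int_inner N u u + 2 * c * d * int_inner N u v + d\<^sup>2 * int_inner N v v"
proof -
  note w = sq_integrable_lincomb[OF assms, of c d]
  show ?thesis
    unfolding int_inner_lincomb[OF assms w] int_inner_commute[of N _ "\<lambda>x. c *\<^sub>R u x + d *\<^sub>R v x"]
      int_inner_lincomb[OF assms assms(1)] int_inner_lincomb[OF assms assms(2)]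
    by (simp add: int_inner_commute[of N v u] power2_eq_square algebra_simps)
qed

text \<open>
  Only a semi-inner product is at hand, as \<open>v\<close> may vanish almost everywhere without being zero;
  that case is treated apart. Otherwise expand the square of \<open>(v, v) u - (u, v) v\<close>.
\<close>

lemma int_inner_Cauchy_Schwarz:
  assumes u: "u \<in> sq_integrable N" and v: "v \<in> sq_integrable N"
  shows "(int_inner N u v)\<^sup>2 \<le> int_inner N u u * int_inner N v v"
proof (cases "int_inner N v v = 0")
  case True
  then have "AE x in N. v x = 0" using int_inner_self_eq_0_iff[OF v] by simp
  then have "AE x in N. u x \<bullet> v x = 0" by auto
  then have "int_inner N u v = 0" unfolding int_inner_def by (rule integral_eq_zero_AE)
  then show ?thesis using True by simp
next
  case False
  then have pos: "int_inner N v v > 0" using int_inner_self_nonneg[of N v] by linarith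
  have "0 \<le> (int_inner N v v)\<^sup>2 * int_inner N u u + 2 * int_inner N v v * (- int_inner N u v) * int_inner N u v + (- int_inner N u v)\<^sup>2 * int_inner N v v"
    by (subst int_inner_self_lincomb[OF u v, symmetric]) (rule int_inner_self_nonneg)
  also have "\<dots> = int_inner N v v * (int_inner N u u * int_inner N v v - (int_inner N u v)\<^sup>2)"
    by (simp add: power2_eq_square algebra_simps)
  finally show ?thesis using pos by (simp add: zero_le_mult_iff)
qed

lemma int_inner_tendsto:
  assumes f: "\<And>n. f n \<in> sq_integrable N" and u: "u \<in> sq_integrable N" and v: "v \<in> sq_integrable N"
    and lim: "(\<lambda>n. int_inner N (\<lambda>x. f n x - u x) (\<lambda>x. f n x - u x)) \<longlonglongrightarrow> 0"
  shows "(\<lambda>n. int_inner N (f n) v) \<longlonglongrightarrow> int_inner N u v"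
proof -
  have "(\<lambda>n. (int_inner N (f n) v - int_inner N u v)\<^sup>2) \<longlonglongrightarrow> 0"
  proof (rule tendsto_sandwich[OF _ _ tendsto_const])
    show "(\<lambda>n. int_inner N (\<lambda>x. f n x - u x) (\<lambda>x. f n x - u x) * int_inner N v v) \<longlonglongrightarrow> 0"
      using tendsto_mult_right[OF lim, of "int_inner N v v"] by simp
    have "(int_inner N (f n) v - int_inner N u v)\<^sup>2 \<le> int_inner N (\<lambda>x. f n x - u x) (\<lambda>x. f n x - u x) * int_inner N v v" for n
      using int_inner_Cauchy_Schwarz[OF sq_integrable_diff[OF f[of n] u] v] by (simp add: int_inner_diff[OF f u v])
    then show "\<forall>\<^sub>F n in sequentially. (int_inner N (f n) v - int_inner N u v)\<^sup>2 \<le> int_inner N (\<lambda>x. f n x - u x) (\<lambda>x. f n x - u x) * int_inner N v v"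
      by simp
  qed auto
  then have "(\<lambda>n. int_inner N (f n) v - int_inner N u v) \<longlonglongrightarrow> 0"
    by simp
  then show ?thesis by (rule LIM_zero_cancel)
qed

section \<open>Completeness and orthogonal projection\<close>

abbreviation dist_sq :: "'a measure \<Rightarrow> ('a \<Rightarrow> 'b::euclidean_space) \<Rightarrow> ('a \<Rightarrow> 'b) \<Rightarrow> real" where
  "dist_sq N u v \<equiv> int_inner N (\<lambda>x. u x - v x) (\<lambda>x. u x - v x)"

lemma nn_integral_norm_sq:
  assumes "u \<in> sq_integrable N"
  shows "(\<integral>\<^sup>+x. ennreal ((norm (u x))\<^sup>2) \<partial>N) = ennreal (int_inner N u u)"
  using assms unfolding int_inner_def sq_integrable_def dot_square_norm
  by (intro nn_integral_eq_integral) auto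

text \<open>
  The pointwise half of the Riesz-Fischer argument: the weights \<open>2\<^sup>k\<close> turn square summability of the
  increments into geometric decay, hence into absolute summability.
\<close>

lemma convergent_if_weighted_square_summable:
  fixes a :: "nat \<Rightarrow> 'b::euclidean_space"
  assumes "summable (\<lambda>k. 2 ^ k * (norm (a (Suc k) - a k))\<^sup>2)"
  shows "convergent a"
proof -
  have "eventually (\<lambda>k. 2 ^ k * (norm (a (Suc k) - a k))\<^sup>2 < 1) sequentially"
    using summable_LIMSEQ_zero[OF assms] by (rule order_tendstoD) simp
  then have "eventually (\<lambda>k. norm (a (Suc k) - a k) \<le> (sqrt (1/2)) ^ k) sequentially"
  proof eventually_elim
    case (elim k)
    then have "(norm (a (Suc k) - a k))\<^sup>2 \<le> (1/2) ^ k"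
      by (simp add: field_simps power_divide)
    then have "sqrt ((norm (a (Suc k) - a k))\<^sup>2) \<le> sqrt ((1/2) ^ k)"
      by (rule real_sqrt_le_mono)
    then show ?case by (simp add: real_sqrt_power)
  qed
  moreover have "summable (\<lambda>k. (sqrt (1/2)) ^ k)"
    by (rule summable_geometric) (simp add: real_sqrt_divide)
  ultimately have "summable (\<lambda>k. a (Suc k) - a k)"
    by (rule summable_comparison_test_ev)
  then have "(\<lambda>n. (\<Sum>k<n. a (Suc k) - a k) + a 0) \<longlonglongrightarrow> suminf (\<lambda>k. a (Suc k) - a k) + a 0"
    by (intro tendsto_add tendsto_const summable_LIMSEQ)
  then show ?thesis
    by (auto simp: sum_lessThan_telescope convergent_def)
qed

text \<open>
  Riesz-Fischer. Along a subsequence with \<open>dist_sq N (f (r (Suc k))) (f (r k)) < (1/4) ^ k\<close> the weighted sum of squared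
  increments has finite integral, so the subsequence converges almost everywhere. Fatou's lemma
  then turns the Cauchy estimate into convergence in mean square of the whole sequence.
\<close>

lemma sq_integrable_complete:
  fixes f :: "nat \<Rightarrow> 'a \<Rightarrow> 'b::euclidean_space"
  assumes f: "\<And>n. f n \<in> sq_integrable N"
    and Cauchy: "\<And>e. e > 0 \<Longrightarrow> \<exists>K. \<forall>m\<ge>K. \<forall>n\<ge>K. dist_sq N (f m) (f n) < e"
  obtains u where "u \<in> sq_integrable N" "(\<lambda>n. dist_sq N (f n) u) \<longlonglongrightarrow> 0"
proof -
  note [measurable] = sq_integrable_measurable[OF f]
  have "\<exists>K. \<forall>k. \<forall>m\<ge>K k. \<forall>n\<ge>K k. dist_sq N (f m) (f n) < (1/4) ^ k"
    using Cauchy by (intro choice allI) simp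
  then obtain K :: "nat \<Rightarrow> nat"
    where K: "\<And>k m n. m \<ge> K k \<Longrightarrow> n \<ge> K k \<Longrightarrow> dist_sq N (f m) (f n) < (1/4) ^ k"
    by blast
  \<comment> \<open>The sum makes \<open>r k\<close> and \<open>r (Suc k)\<close> exceed \<open>K k\<close>; the summand \<open>k\<close> makes \<open>r\<close> unbounded.\<close>
  define r where "r k = k + (\<Sum>i\<le>k. K i)" for k
  have rK: "r k \<ge> K k" for k
    using member_le_sum[of k "{..k}" K] unfolding r_def by simp
  have rK': "r (Suc k) \<ge> K k" for k
    using member_le_sum[of k "{..Suc k}" K] unfolding r_def by simp
  define g where "g k x = 2 ^ k * (norm (f (r (Suc k)) x - f (r k) x))\<^sup>2" for k x
  have gm[measurable]: "g k \<in> borel_measurable N" for k unfolding g_def by measurable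
  have gi: "(\<integral>\<^sup>+x. ennreal (g k x) \<partial>N) \<le> ennreal ((1/2) ^ k)" for k
  proof -
    have "(\<integral>\<^sup>+x. ennreal (g k x) \<partial>N) = (\<integral>\<^sup>+x. ennreal (2 ^ k) * ennreal ((norm (f (r (Suc k)) x - f (r k) x))\<^sup>2) \<partial>N)"
      by (simp add: g_def ennreal_mult)
    also have "\<dots> = ennreal (2 ^ k) * ennreal (dist_sq N (f (r (Suc k))) (f (r k)))"
      by (subst nn_integral_cmult) (auto simp: nn_integral_norm_sq[OF sq_integrable_diff[OF f f]])
    also have "\<dots> \<le> ennreal (2 ^ k) * ennreal ((1/4) ^ k)"
      by (intro mult_left_mono ennreal_leI less_imp_le K rK rK') auto
    also have "\<dots> = ennreal ((1/2) ^ k)"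
      by (simp add: ennreal_mult[symmetric] power_mult_distrib[symmetric])
    finally show ?thesis .
  qed
  have "(\<integral>\<^sup>+x. (\<Sum>k. ennreal (g k x)) \<partial>N) = (\<Sum>k. \<integral>\<^sup>+x. ennreal (g k x) \<partial>N)"
    by (rule nn_integral_suminf) auto
  also have "\<dots> \<le> (\<Sum>k. ennreal ((1/2) ^ k))"
    by (intro suminf_le gi) auto
  also have "\<dots> = ennreal (\<Sum>k. (1/2) ^ k)"
    by (intro suminf_ennreal2) (auto intro: summable_geometric)
  also have "\<dots> < \<infinity>" by simp
  finally have "AE x in N. (\<Sum>k. ennreal (g k x)) \<noteq> \<infinity>"
    by (intro nn_integral_PInf_AE) auto
  then have conv: "AE x in N. convergent (\<lambda>k. f (r k) x)"
  proof eventually_elim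
    case (elim x)
    have "summable (\<lambda>k. g k x)"
      by (rule summable_suminf_not_top) (use elim in \<open>auto simp: g_def\<close>)
    then show ?case
      by (intro convergent_if_weighted_square_summable) (simp add: g_def)
  qed
  define u where "u x = lim (\<lambda>k. f (r k) x)" for x
  have um[measurable]: "u \<in> borel_measurable N"
    unfolding u_def by measurable
  have lim: "AE x in N. (\<lambda>k. f (r k) x) \<longlonglongrightarrow> u x"
    using conv by eventually_elim (simp add: u_def convergent_LIMSEQ_iff)
  have Fatou: "(\<integral>\<^sup>+x. ennreal ((norm (f n x - u x))\<^sup>2) \<partial>N) \<le> ennreal e"
    if n: "n \<ge> k" and k: "\<And>m n. m \<ge> k \<Longrightarrow> n \<ge> k \<Longrightarrow> dist_sq N (f m) (f n) < e" for n k e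
  proof -
    have "(\<integral>\<^sup>+x. ennreal ((norm (f n x - u x))\<^sup>2) \<partial>N)
        = (\<integral>\<^sup>+x. liminf (\<lambda>j. ennreal ((norm (f n x - f (r j) x))\<^sup>2)) \<partial>N)"
    proof (rule nn_integral_cong_AE, use lim in eventually_elim)
      case (elim x)
      have "(\<lambda>j. ennreal ((norm (f n x - f (r j) x))\<^sup>2)) \<longlonglongrightarrow> ennreal ((norm (f n x - u x))\<^sup>2)"
        by (intro tendsto_intros elim)
      then show ?case by (intro lim_imp_Liminf[symmetric]) auto
    qed
    also have "\<dots> \<le> liminf (\<lambda>j. \<integral>\<^sup>+x. ennreal ((norm (f n x - f (r j) x))\<^sup>2) \<partial>N)"
      by (intro nn_integral_liminf) measurable
    also have "\<dots> \<le> limsup (\<lambda>j. \<integral>\<^sup>+x. ennreal ((norm (f n x - f (r j) x))\<^sup>2) \<partial>N)"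
      by (intro Liminf_le_Limsup) auto
    also have "\<dots> \<le> ennreal e"
    proof (rule Limsup_bounded)
      have "\<integral>\<^sup>+x. ennreal ((norm (f n x - f (r j) x))\<^sup>2) \<partial>N \<le> ennreal e" if "j \<ge> k" for j
        unfolding nn_integral_norm_sq[OF sq_integrable_diff[OF f f]]
        by (intro ennreal_leI less_imp_le[OF k] n) (use that in \<open>simp add: r_def\<close>)
      then show "\<forall>\<^sub>F j in sequentially. \<integral>\<^sup>+x. ennreal ((norm (f n x - f (r j) x))\<^sup>2) \<partial>N \<le> ennreal e"
        by (auto simp: eventually_sequentially)
    qed
    finally show ?thesis .
  qed
  have diff: "(\<lambda>x. f n x - u x) \<in> sq_integrable N \<and> dist_sq N (f n) u \<le> e"
    if n: "n \<ge> k" and e: "e > 0" and k: "\<And>m n. m \<ge> k \<Longrightarrow> n \<ge> k \<Longrightarrow> dist_sq N (f m) (f n) < e" for n k e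
  proof -
    note F = Fatou[OF n k]
    have "(\<integral>\<^sup>+x. ennreal ((norm (f n x - u x))\<^sup>2) \<partial>N) < \<infinity>"
      using F by (rule le_less_trans) auto
    then have *: "(\<lambda>x. f n x - u x) \<in> sq_integrable N"
      unfolding sq_integrable_def by (auto intro!: integrableI_nonneg)
    show ?thesis
      using F e unfolding nn_integral_norm_sq[OF *] by (auto simp: *)
  qed
  have "u \<in> sq_integrable N"
  proof -
    obtain k where k: "\<And>m n. m \<ge> k \<Longrightarrow> n \<ge> k \<Longrightarrow> dist_sq N (f m) (f n) < 1"
      using Cauchy[of 1] by auto
    have "(\<lambda>x. f k x - u x) \<in> sq_integrable N" using diff[of k k 1] k by auto
    from sq_integrable_diff[OF f[of k] this] show ?thesis by simp
  qed
  moreover have "(\<lambda>n. dist_sq N (f n) u) \<longlonglongrightarrow> 0"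
  proof (rule LIMSEQ_I)
    fix e :: real assume e: "e > 0"
    then obtain k where k: "\<And>m n. m \<ge> k \<Longrightarrow> n \<ge> k \<Longrightarrow> dist_sq N (f m) (f n) < e / 2"
      using Cauchy[of "e/2"] by auto
    have "norm (dist_sq N (f n) u - 0) < e" if "n \<ge> k" for n
      using diff[of k n "e/2"] that k e int_inner_self_nonneg[of N "\<lambda>x. f n x - u x"] by fastforce
    then show "\<exists>no. \<forall>n\<ge>no. norm (dist_sq N (f n) u - 0) < e" by blast
  qed
  ultimately show thesis by (rule that)
qed

lemma sq_integrable_tendsto_AE_subseq:
  assumes f: "\<And>n. f n \<in> sq_integrable N" and u: "u \<in> sq_integrable N" and lim: "(\<lambda>n. dist_sq N (f n) u) \<longlonglongrightarrow> 0"
  obtains r :: "nat \<Rightarrow> nat" where "strict_mono r" "AE x in N. (\<lambda>n. f (r n) x) \<longlonglongrightarrow> u x"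
proof -
  have "\<exists>r. strict_mono r \<and> (AE x in N. (\<lambda>n. (norm (f (r n) x - u x))\<^sup>2) \<longlonglongrightarrow> 0)"
  proof (rule tendsto_L1_AE_subseq)
    show "integrable N (\<lambda>x. (norm (f n x - u x))\<^sup>2)" for n
      using sq_integrable_diff[OF f u] by (simp add: sq_integrable_def)
    show "(\<lambda>n. LINT x|N. norm ((norm (f n x - u x))\<^sup>2)) \<longlonglongrightarrow> 0"
      using lim by (simp add: int_inner_def dot_square_norm)
  qed
  then obtain r :: "nat \<Rightarrow> nat" where r: "strict_mono r" and ae: "AE x in N. (\<lambda>n. (norm (f (r n) x - u x))\<^sup>2) \<longlonglongrightarrow> 0"
    by blast
  from ae have "AE x in N. (\<lambda>n. f (r n) x) \<longlonglongrightarrow> u x"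
  proof eventually_elim
    case (elim x)
    then have "(\<lambda>n. norm (f (r n) x - u x)) \<longlonglongrightarrow> 0"
      by simp
    then show ?case by (simp add: tendsto_norm_zero_iff LIM_zero_iff)
  qed
  with r show thesis by (rule that)
qed

text \<open>
  A minimizing sequence for the distance to \<open>G\<close> is Cauchy by the parallelogram identity, and its limit
  lies in \<open>W\<close>. Perturbing the sequence in the direction \<open>v\<close> gives the orthogonality relation.
  Functions are not identified with their classes here, so \<open>W\<close> has to contain every function that
  is a limit in mean square.
\<close>

lemma projection_exists:
  fixes W :: "('a \<Rightarrow> 'b::euclidean_space) set"
  assumes ne: "W \<noteq> {}" and sub: "W \<subseteq> sq_integrable N"
    and lin: "\<And>u v c d. u \<in> W \<Longrightarrow> v \<in> W \<Longrightarrow> (\<lambda>x. c *\<^sub>R u x + d *\<^sub>R v x) \<in> W"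
    and closed: "\<And>f u. (\<And>n::nat. f n \<in> W) \<Longrightarrow> u \<in> sq_integrable N \<Longrightarrow> (\<lambda>n. dist_sq N (f n) u) \<longlonglongrightarrow> 0 \<Longrightarrow> u \<in> W"
    and G: "G \<in> sq_integrable N"
  obtains w where "w \<in> W" "\<And>v. v \<in> W \<Longrightarrow> int_inner N w v = int_inner N G v"
proof -
  define d where "d = Inf ((\<lambda>w. dist_sq N G w) ` W)"
  have bdd: "bdd_below ((\<lambda>w. dist_sq N G w) ` W)"
    by (intro bdd_belowI[of _ 0]) (auto simp: int_inner_self_nonneg)
  have d_le: "d \<le> dist_sq N G w" if "w \<in> W" for w
    unfolding d_def by (rule cInf_lower) (use that bdd in auto)
  have "\<exists>w. w \<in> W \<and> dist_sq N G w < d + inverse (real (Suc n))" for n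
  proof -
    have "Inf ((\<lambda>w. dist_sq N G w) ` W) < d + inverse (real (Suc n))" unfolding d_def by simp
    from cInf_lessD[OF _ this] ne show ?thesis by auto
  qed
  then obtain f where fW: "\<And>n. f n \<in> W" and fd: "\<And>n. dist_sq N G (f n) < d + inverse (real (Suc n))"
    by metis
  have f: "f n \<in> sq_integrable N" for n using fW sub by auto
  have parallelogram: "dist_sq N (f m) (f n) < 2 * inverse (real (Suc m)) + 2 * inverse (real (Suc n))" for m n
  proof -
    \<comment> \<open>The midpoint lies in \<open>W\<close>, so its squared distance from \<open>G\<close> is at least \<open>d\<close>.\<close>
    define h where "h x = (1/2) *\<^sub>R f m x + (1/2) *\<^sub>R f n x" for x
    have hW: "h \<in> W" unfolding h_def by (rule lin) (rule fW)+
    then have h: "h \<in> sq_integrable N" using sub by auto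
    note I = sq_integrable_inner_integrable[OF sq_integrable_diff sq_integrable_diff]
    have "dist_sq N (f m) (f n) + 4 * dist_sq N G h = 2 * dist_sq N G (f m) + 2 * dist_sq N G (f n)"
    proof -
      have "dist_sq N (f m) (f n) + 4 * dist_sq N G h =
         (\<integral>x. (f m x - f n x) \<bullet> (f m x - f n x) + 4 * ((G x - h x) \<bullet> (G x - h x)) \<partial>N)"
        unfolding int_inner_def using I[OF f f f f] I[OF G h G h] by simp
      also have "\<dots> = (\<integral>x. 2 * ((G x - f m x) \<bullet> (G x - f m x)) + 2 * ((G x - f n x) \<bullet> (G x - f n x)) \<partial>N)"
        by (intro Bochner_Integration.integral_cong refl)
           (simp add: h_def inner_diff inner_add inner_commute algebra_simps)
      also have "\<dots> = 2 * dist_sq N G (f m) + 2 * dist_sq N G (f n)"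
        unfolding int_inner_def using I[OF G f G f] by simp
      finally show ?thesis .
    qed
    with d_le[OF hW] fd[of m] fd[of n] show ?thesis by simp
  qed
  have "\<exists>K. \<forall>m\<ge>K. \<forall>n\<ge>K. dist_sq N (f m) (f n) < e" if "e > 0" for e
  proof -
    have "e / 4 > 0" using that by simp
    then obtain K where K: "inverse (real (Suc K)) < e / 4" by (rule reals_Archimedean[THEN exE])
    have "inverse (real (Suc m)) < e / 4" if "m \<ge> K" for m
      by (rule le_less_trans[OF _ K]) (use that in \<open>simp add: field_simps\<close>)
    note small = this
    have "dist_sq N (f m) (f n) < e" if "m \<ge> K" "n \<ge> K" for m n
      using parallelogram[of m n] small[OF that(1)] small[OF that(2)] by linarith
    then show ?thesis by blast
  qed
  from sq_integrable_complete[OF f this] obtain w where w: "w \<in> sq_integrable N" and lim: "(\<lambda>n. dist_sq N (f n) w) \<longlonglongrightarrow> 0"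
    by blast
  have wW: "w \<in> W" by (rule closed[OF fW w lim])
  have "int_inner N w v = int_inner N G v" if vW: "v \<in> W" for v
  proof -
    have v: "v \<in> sq_integrable N" using vW sub by auto
    have var: "0 \<le> s\<^sup>2 * int_inner N v v - 2 * s * (int_inner N G v - int_inner N w v)" for s
    proof (rule LIMSEQ_le_const)
      have "(\<lambda>n. s\<^sup>2 * int_inner N v v - 2 * s * (int_inner N G v - int_inner N (f n) v) + inverse (real (Suc n)))
          \<longlonglongrightarrow> s\<^sup>2 * int_inner N v v - 2 * s * (int_inner N G v - int_inner N w v) + 0"
        by (intro tendsto_intros int_inner_tendsto[OF f w v lim] LIMSEQ_inverse_real_of_nat)
      then show "(\<lambda>n. s\<^sup>2 * int_inner N v v - 2 * s * (int_inner N G v - int_inner N (f n) v) + inverse (real (Suc n)))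
          \<longlonglongrightarrow> s\<^sup>2 * int_inner N v v - 2 * s * (int_inner N G v - int_inner N w v)" by simp
      have "0 \<le> s\<^sup>2 * int_inner N v v - 2 * s * (int_inner N G v - int_inner N (f n) v) + inverse (real (Suc n))" for n
      proof -
        have "d \<le> dist_sq N G (\<lambda>x. 1 *\<^sub>R f n x + s *\<^sub>R v x)"
          by (rule d_le) (rule lin[OF fW vW])
        also have "\<dots> = int_inner N (\<lambda>x. 1 *\<^sub>R (G x - f n x) + (- s) *\<^sub>R v x) (\<lambda>x. 1 *\<^sub>R (G x - f n x) + (- s) *\<^sub>R v x)"
          by (simp add: algebra_simps)
        also have "\<dots> = dist_sq N G (f n) - 2 * s * (int_inner N G v - int_inner N (f n) v) + s\<^sup>2 * int_inner N v v"
          by (subst int_inner_self_lincomb[OF sq_integrable_diff[OF G f] v]) (simp add: int_inner_diff[OF G f v])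
        finally show ?thesis using fd[of n] by linarith
      qed
      then show "\<exists>M. \<forall>n\<ge>M. 0 \<le> s\<^sup>2 * int_inner N v v - 2 * s * (int_inner N G v - int_inner N (f n) v) + inverse (real (Suc n))"
        by blast
    qed
    define p where "p = int_inner N G v - int_inner N w v"
    \<comment> \<open>The step \<open>s = p / q\<close> makes the quadratic negative unless \<open>p = 0\<close>, for any \<open>q > (v, v)\<close>;
      adding 1 keeps \<open>q\<close> positive when \<open>v\<close> is null.\<close>
    define q where "q = int_inner N v v + 1"
    have q: "q > 0" "int_inner N v v < q" using int_inner_self_nonneg[of N v] by (auto simp: q_def)
    have "0 \<le> (p/q)\<^sup>2 * int_inner N v v - 2 * (p/q) * p" using var[of "p/q"] unfolding p_def .
    also have "\<dots> \<le> (p/q)\<^sup>2 * q - 2 * (p/q) * p" using q by (simp add: mult_left_mono)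
    also have "\<dots> = - (p\<^sup>2 / q)" using q by (simp add: field_simps power2_eq_square)
    finally have "p\<^sup>2 / q \<le> 0" by simp
    then have "p = 0" using q by (simp add: divide_le_0_iff)
    then show ?thesis by (simp add: p_def)
  qed
  with wW show thesis by (rule that)
qed

lemma sq_integrable_bounded_linear:
  assumes T: "bounded_linear T" and u: "u \<in> sq_integrable N"
  shows "(\<lambda>x. T (u x)) \<in> sq_integrable N"
proof (rule sq_integrable_bound)
  have "T \<in> borel_measurable borel"
    using T by (intro borel_measurable_continuous_onI linear_continuous_on)
  then show "(\<lambda>x. T (u x)) \<in> borel_measurable N"
    using sq_integrable_measurable[OF u] by measurable
  show "integrable N (\<lambda>x. (onorm T)\<^sup>2 * (norm (u x))\<^sup>2)"
    using u by (auto simp: sq_integrable_def)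
  show "AE x in N. (norm (T (u x)))\<^sup>2 \<le> (onorm T)\<^sup>2 * (norm (u x))\<^sup>2"
    using onorm[OF T] by (auto simp: power_mult_distrib[symmetric] intro!: power_mono)
qed

lemma dist_sq_tendsto_bounded_linear:
  assumes T: "bounded_linear T" and f: "\<And>n. f n \<in> sq_integrable N" and u: "u \<in> sq_integrable N"
    and lim: "(\<lambda>n. dist_sq N (f n) u) \<longlonglongrightarrow> 0"
  shows "(\<lambda>n. dist_sq N (\<lambda>x. T (f n x)) (\<lambda>x. T (u x))) \<longlonglongrightarrow> 0"
proof (rule tendsto_sandwich[OF _ _ tendsto_const])
  show "(\<lambda>n. (onorm T)\<^sup>2 * dist_sq N (f n) u) \<longlonglongrightarrow> 0"
    using tendsto_mult_left[OF lim, of "(onorm T)\<^sup>2"] by simp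
  have "dist_sq N (\<lambda>x. T (f n x)) (\<lambda>x. T (u x)) \<le> (onorm T)\<^sup>2 * dist_sq N (f n) u" for n
  proof -
    have d: "(\<lambda>x. f n x - u x) \<in> sq_integrable N" by (rule sq_integrable_diff[OF f u])
    have eq: "T (f n x) - T (u x) = T (f n x - u x)" for x
      using T by (simp add: linear_diff bounded_linear.linear)
    have "dist_sq N (\<lambda>x. T (f n x)) (\<lambda>x. T (u x)) = (\<integral>x. (norm (T (f n x - u x)))\<^sup>2 \<partial>N)"
      by (simp add: int_inner_def eq dot_square_norm)
    also have "\<dots> \<le> (\<integral>x. (onorm T)\<^sup>2 * (norm (f n x - u x))\<^sup>2 \<partial>N)"
    proof (rule integral_mono)
      show "integrable N (\<lambda>x. (norm (T (f n x - u x)))\<^sup>2)"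
        using sq_integrable_bounded_linear[OF T d] by (simp add: sq_integrable_def)
      show "integrable N (\<lambda>x. (onorm T)\<^sup>2 * (norm (f n x - u x))\<^sup>2)"
        using d by (auto simp: sq_integrable_def)
      show "(norm (T (f n x - u x)))\<^sup>2 \<le> (onorm T)\<^sup>2 * (norm (f n x - u x))\<^sup>2" for x
        using onorm[OF T] by (auto simp: power_mult_distrib[symmetric] intro!: power_mono)
    qed
    finally show ?thesis by (simp add: int_inner_def dot_square_norm)
  qed
  then show "\<forall>\<^sub>F n in sequentially. dist_sq N (\<lambda>x. T (f n x)) (\<lambda>x. T (u x)) \<le> (onorm T)\<^sup>2 * dist_sq N (f n) u"
    by simp
qed (simp add: int_inner_self_nonneg)

lemma sq_integrable_Pair:
  assumes "u \<in> sq_integrable N" "v \<in> sq_integrable N"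
  shows "(\<lambda>x. (u x, v x)) \<in> sq_integrable N"
  using assms by (auto simp: sq_integrable_def norm_Pair)

lemma int_inner_Pair:
  assumes "u \<in> sq_integrable N" "v \<in> sq_integrable N" "u' \<in> sq_integrable N" "v' \<in> sq_integrable N"
  shows "int_inner N (\<lambda>x. (u x, v x)) (\<lambda>x. (u' x, v' x)) = int_inner N u u' + int_inner N v v'"
  using sq_integrable_inner_integrable[OF assms(1,3)] sq_integrable_inner_integrable[OF assms(2,4)]
  by (simp add: int_inner_def)

lemma int_inner_scale:
  assumes "u \<in> sq_integrable N" "v \<in> sq_integrable N"
  shows "int_inner N (\<lambda>x. c *\<^sub>R u x) v = c * int_inner N u v" "int_inner N u (\<lambda>x. c *\<^sub>R v x) = c * int_inner N u v"
  using int_inner_lincomb[OF assms(1,1,2), of c 0] int_inner_lincomb[OF assms(2,2,1), of c 0]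
  by (simp_all add: int_inner_commute[of N u])

section \<open>Smooth functions with support in a box\<close>

text \<open>
  For \<open>p = 1\<close> the standard example of a smooth function that vanishes on a half-line; the polynomial
  factor makes the family closed under differentiation.
\<close>

definition flat_exp :: "real poly \<Rightarrow> real \<Rightarrow> real" where
  "flat_exp p t = (if t > 0 then poly p (inverse t) * exp (- inverse t) else 0)"

lemma poly_exp_minus_tendsto_0: "((\<lambda>s::real. poly p s * exp (- s)) \<longlongrightarrow> 0) at_top"
proof -
  have "((\<lambda>s::real. \<Sum>i\<le>degree p. coeff p i * (s ^ i / exp s)) \<longlongrightarrow> (\<Sum>i\<le>degree p. coeff p i * 0)) at_top"
    by (intro tendsto_sum tendsto_mult tendsto_const tendsto_power_div_exp_0)
  then show ?thesis
    by (simp add: poly_altdef sum_distrib_right sum_divide_distrib exp_minus field_simps)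
qed

text \<open>
  Away from the origin this is the chain rule, \<open>monom 1 2\<close> coming from the derivative of \<open>1 / t\<close>. At the
  origin the difference quotient is again of the form \<open>q (1 / t) exp (- 1 / t)\<close> and tends to zero.
\<close>

lemma flat_exp_has_derivative:
  "(flat_exp p has_real_derivative flat_exp (monom 1 2 * (p - pderiv p)) t) (at t)"
proof (cases t "0::real" rule: linorder_cases)
  case greater
  have "((\<lambda>t. poly p (inverse t) * exp (- inverse t)) has_real_derivative flat_exp (monom 1 2 * (p - pderiv p)) t) (at t)"
    using greater
    by (auto intro!: derivative_eq_intros DERIV_chain2[OF poly_DERIV] simp: flat_exp_def poly_monom power2_eq_square algebra_simps)
  then show ?thesis
    by (rule has_field_derivative_transform_within_open[of _ _ _ "{0<..}"])
       (use greater in \<open>auto simp: flat_exp_def\<close>)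
next
  case less
  have "((\<lambda>t. 0) has_real_derivative flat_exp (monom 1 2 * (p - pderiv p)) t) (at t)"
    using less by (auto simp: flat_exp_def)
  then show ?thesis
    by (rule has_field_derivative_transform_within_open[of _ _ _ "{..<0}"])
       (use less in \<open>auto simp: flat_exp_def\<close>)
next
  case equal
  have "((\<lambda>h. flat_exp p h / h) \<longlongrightarrow> 0) (at 0)"
    unfolding filterlim_at_split
  proof
    show "((\<lambda>h. flat_exp p h / h) \<longlongrightarrow> 0) (at_left 0)"
      by (rule tendsto_eventually) (auto simp: eventually_at_filter flat_exp_def)
    have "((\<lambda>h. poly (pCons 0 p) (inverse h) * exp (- inverse h)) \<longlongrightarrow> 0) (at_right 0)"
      by (rule filterlim_compose[OF poly_exp_minus_tendsto_0 filterlim_inverse_at_top_right])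
    then show "((\<lambda>h. flat_exp p h / h) \<longlongrightarrow> 0) (at_right 0)"
      by (rule Lim_transform_eventually) (auto simp: eventually_at_filter flat_exp_def field_simps)
  qed
  then show ?thesis using equal by (simp add: DERIV_def flat_exp_def)
qed

text \<open>
  An algebra of functions that contains the building blocks of the bumps and is closed under partial
  derivatives. Closure under one derivative already gives derivatives of all orders, which avoids
  any formula for the higher derivatives of a product.
\<close>

inductive smooth_alg :: "(real^'d::finite \<Rightarrow> real) \<Rightarrow> bool" where
  flat: "smooth_alg (\<lambda>x. flat_exp p (c * x $ i + e))"
| const: "smooth_alg (\<lambda>x. c)"
| add: "smooth_alg u \<Longrightarrow> smooth_alg v \<Longrightarrow> smooth_alg (\<lambda>x. u x + v x)"
| mult: "smooth_alg u \<Longrightarrow> smooth_alg v \<Longrightarrow> smooth_alg (\<lambda>x. u x * v x)"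

lemma partial_deriv_eqI: "(f has_derivative D) (at x) \<Longrightarrow> partial_deriv i f x = D (axis i 1)"
  by (simp add: partial_deriv_def frechet_derivative_at[symmetric])

text \<open>
  The derivative is recorded together with its directional values, which stay in the algebra; this is
  the form in which the statement passes through the induction.
\<close>

lemma smooth_alg_derivative:
  assumes "smooth_alg u"
  shows "\<exists>D. (\<forall>x. (u has_derivative D x) (at x)) \<and> (\<forall>h. smooth_alg (\<lambda>x. D x h))"
  using assms
proof induction
  case (flat p c i e)
  define q where "q = monom 1 2 * (p - pderiv p)"
  have "((\<lambda>x::real^'a. flat_exp p (c * x $ i + e)) has_derivative (\<lambda>h. flat_exp q (c * x $ i + e) * (c * h $ i))) (at x)" for x
  proof (rule has_derivative_compose[where g = "flat_exp p" and g' = "\<lambda>h. flat_exp q (c * x $ i + e) * h"])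
    show "((\<lambda>x::real^'a. c * x $ i + e) has_derivative (\<lambda>h. c * h $ i)) (at x)"
      by (auto intro!: derivative_eq_intros bounded_linear.has_derivative[OF bounded_linear_vec_nth])
    show "(flat_exp p has_derivative (\<lambda>h. flat_exp q (c * x $ i + e) * h)) (at (c * x $ i + e))"
      using flat_exp_has_derivative[of p "c * x $ i + e"] by (simp add: has_field_derivative_def q_def)
  qed
  moreover have "smooth_alg (\<lambda>x::real^'a. flat_exp q (c * x $ i + e) * (c * h $ i))" for h :: "real^'a"
    by (intro smooth_alg.intros)
  ultimately show ?case
    by (intro exI[of _ "\<lambda>x h. flat_exp q (c * x $ i + e) * (c * h $ i)"]) auto
next
  case (const c)
  show ?case by (rule exI[of _ "\<lambda>x h. 0"]) (auto intro: smooth_alg.intros)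
next
  case (add u v)
  then obtain D E where D: "\<And>x. (u has_derivative D x) (at x)" "\<And>h. smooth_alg (\<lambda>x. D x h)"
    and E: "\<And>x. (v has_derivative E x) (at x)" "\<And>h. smooth_alg (\<lambda>x. E x h)" by metis
  show ?case
    by (rule exI[of _ "\<lambda>x h. D x h + E x h"]) (auto intro!: smooth_alg.add D E has_derivative_add)
next
  case (mult u v)
  then obtain D E where D: "\<And>x. (u has_derivative D x) (at x)" "\<And>h. smooth_alg (\<lambda>x. D x h)"
    and E: "\<And>x. (v has_derivative E x) (at x)" "\<And>h. smooth_alg (\<lambda>x. E x h)" by metis
  show ?case
    by (rule exI[of _ "\<lambda>x h. u x * E x h + D x h * v x"])
      (auto intro!: smooth_alg.add smooth_alg.mult mult.hyps D E has_derivative_mult)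
qed

lemma smooth_alg_C_infinity:
  assumes "smooth_alg u"
  shows "u \<in> C_infinity"
proof -
  have "C_k k u" for k
    using assms
  proof (induction k arbitrary: u)
    case 0
    then show ?case
      using smooth_alg_derivative[OF 0] has_derivative_continuous
      by (auto intro!: continuous_at_imp_continuous_on) blast
  next
    case (Suc k)
    obtain D where D: "\<And>x. (u has_derivative D x) (at x)" "\<And>h. smooth_alg (\<lambda>x. D x h)"
      using smooth_alg_derivative[OF Suc.prems] by metis
    have "partial_deriv i u = (\<lambda>x. D x (axis i 1))" for i
      using D(1) by (auto simp: partial_deriv_eqI)
    then show ?case
      using D Suc.IH[OF D(2)] by (auto simp: differentiable_on_def differentiable_def)
  qed
  then show ?thesis by (simp add: C_infinity_def)
qed

lemma smooth_alg_prod: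
  "finite I \<Longrightarrow> (\<And>i. i \<in> I \<Longrightarrow> smooth_alg (g i)) \<Longrightarrow> smooth_alg (\<lambda>x. \<Prod>i\<in>I. g i x)"
  by (induction I rule: finite_induct) (auto intro: smooth_alg.intros)

text \<open>
  For \<open>k > 0\<close> the two factors of a coordinate are both positive exactly for \<open>a $ i < x $ i < b $ i\<close>. The arguments
  are written as affine functions \<open>c * x $ i + e\<close> to fit the generators of \<open>smooth_alg\<close>.
\<close>

definition box_bump :: "real^'d::finite \<Rightarrow> real^'d \<Rightarrow> nat \<Rightarrow> real^'d \<Rightarrow> real" where
  "box_bump a b k x =
     (\<Prod>i\<in>UNIV. flat_exp 1 (real k * x $ i + - (real k * a $ i)) *
                 flat_exp 1 (- real k * x $ i + real k * b $ i))"

lemma box_bump_C_infinity: "box_bump a b k \<in> C_infinity"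
  unfolding box_bump_def[abs_def]
  by (intro smooth_alg_C_infinity smooth_alg_prod smooth_alg.mult smooth_alg.flat) simp

lemma flat_exp_1_bounds: "0 \<le> flat_exp 1 t" "flat_exp 1 t \<le> 1"
  by (auto simp: flat_exp_def)

lemma box_bump_bounds: "0 \<le> box_bump a b k x" "box_bump a b k x \<le> 1"
  unfolding box_bump_def
  by (auto intro!: prod_nonneg prod_le_1 mult_nonneg_nonneg mult_le_one simp: flat_exp_1_bounds)

lemma box_bump_outside: "x \<notin> box a b \<Longrightarrow> box_bump a b k x = 0"
proof -
  assume "x \<notin> box a b"
  then obtain i where "x $ i \<le> a $ i \<or> b $ i \<le> x $ i"
    by (auto simp: mem_box_cart not_less)
  then have "real k * x $ i \<le> real k * a $ i \<or> real k * b $ i \<le> real k * x $ i"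
    by (auto intro: mult_left_mono)
  then have "flat_exp 1 (real k * x $ i + - (real k * a $ i)) * flat_exp 1 (- real k * x $ i + real k * b $ i) = 0"
    by (auto simp: flat_exp_def)
  then show ?thesis
    unfolding box_bump_def by (intro prod_zero) auto
qed

lemma box_bump_tendsto: "(\<lambda>k. box_bump a b k x) \<longlonglongrightarrow> indicator (box a b) x"
proof (cases "x \<in> box a b")
  case True
  have lim: "(\<lambda>k. flat_exp 1 (real k * s)) \<longlonglongrightarrow> 1" if "s > 0" for s
  proof -
    have "(\<lambda>k. exp (- (inverse (real k) * inverse s))) \<longlonglongrightarrow> exp (- (0 * inverse s))"
      by (intro tendsto_intros lim_inverse_n)
    then have "(\<lambda>k. exp (- (inverse (real k) * inverse s))) \<longlonglongrightarrow> 1" by simp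
    then show ?thesis
    proof (rule Lim_transform_eventually)
      show "\<forall>\<^sub>F k in sequentially. exp (- (inverse (real k) * inverse s)) = flat_exp 1 (real k * s)"
        using eventually_gt_at_top[of 0] by eventually_elim (use that in \<open>simp add: flat_exp_def\<close>)
    qed
  qed
  have "(\<lambda>k. \<Prod>i\<in>UNIV. flat_exp 1 (real k * (x $ i - a $ i)) * flat_exp 1 (real k * (b $ i - x $ i)))
      \<longlonglongrightarrow> (\<Prod>i\<in>(UNIV::'a set). 1 * 1)"
    using True by (intro tendsto_prod tendsto_mult lim) (auto simp: mem_box_cart)
  then show ?thesis using True by (simp add: box_bump_def algebra_simps)
next
  case False
  then show ?thesis by (simp add: box_bump_outside)
qed

lemma box_bump_test_function:
  assumes "cbox a b \<subseteq> \<Omega>"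
  shows "box_bump a b k \<in> test_functions \<Omega>"
proof -
  have "{x. box_bump a b k x \<noteq> 0} \<subseteq> cbox a b"
    using box_bump_outside box_subset_cbox by blast
  then have *: "closure {x. box_bump a b k x \<noteq> 0} \<subseteq> cbox a b"
    by (intro closure_minimal) auto
  then have "compact (closure {x. box_bump a b k x \<noteq> 0})"
    using bounded_subset[OF bounded_cbox *] by (simp add: compact_eq_bounded_closed)
  with * assms show ?thesis
    unfolding test_functions_def using box_bump_C_infinity[of a b k] by auto
qed

section \<open>The fundamental lemma of the calculus of variations\<close>

text \<open>
  By Henstock's lemma the sums \<open>\<Sum> |K| \<bar>f x\<bar>\<close> over fine tagged divisions are small as soon as the
  integrals over the pieces vanish, so the integral of \<open>\<bar>f\<bar>\<close> is zero.
\<close>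

lemma zero_integrals_imp_AE_zero:
  fixes f :: "'a::euclidean_space \<Rightarrow> real"
  assumes f: "set_integrable lebesgue (cbox a b) f"
    and zero: "\<And>c d. cbox c d \<subseteq> cbox a b \<Longrightarrow> integral (cbox c d) f = 0"
  shows "AE x\<in>cbox a b in lebesgue. f x = 0"
proof -
  have fi: "f integrable_on cbox a b"
    using set_lebesgue_integral_eq_integral(1)[OF f] .
  have "((\<lambda>x. \<bar>f x\<bar>) has_integral 0) (cbox a b)"
    unfolding has_integral
  proof (intro allI impI)
    fix e :: real assume e: "e > 0"
    obtain \<gamma> where \<gamma>: "gauge \<gamma>" and small: "\<And>p. p tagged_partial_division_of (cbox a b) \<Longrightarrow> \<gamma> fine p \<Longrightarrow>
        (\<Sum>(x, k)\<in>p. norm (measure lborel k *\<^sub>R f x - integral k f)) < e"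
      by (rule Henstock_lemma[OF fi e]) (rule that)
    have "norm ((\<Sum>(x, k)\<in>p. measure lborel k *\<^sub>R \<bar>f x\<bar>) - 0) < e"
      if p: "p tagged_division_of cbox a b" "\<gamma> fine p" for p
    proof -
      have "(\<Sum>(x, k)\<in>p. measure lborel k *\<^sub>R \<bar>f x\<bar>) = (\<Sum>(x, k)\<in>p. norm (measure lborel k *\<^sub>R f x - integral k f))"
      proof (intro sum.cong refl)
        fix xk assume "xk \<in> p"
        moreover obtain x k where xk: "xk = (x, k)" by (cases xk)
        ultimately have "(x, k) \<in> p" by simp
        then obtain c d where "k = cbox c d" "k \<subseteq> cbox a b"
          using tagged_division_ofD(3,4)[OF p(1), of x k] by blast
        then have "integral k f = 0" using zero by simp
        then show "(case xk of (x, k) \<Rightarrow> measure lborel k *\<^sub>R \<bar>f x\<bar>) = (case xk of (x, k) \<Rightarrow> norm (measure lborel k *\<^sub>R f x - integral k f))"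
          by (simp add: xk abs_mult)
      qed
      moreover have "0 \<le> (\<Sum>(x, k)\<in>p. measure lborel k *\<^sub>R \<bar>f x\<bar>)"
        by (auto intro!: sum_nonneg)
      moreover have "p tagged_partial_division_of cbox a b"
        using p(1) by (simp add: tagged_division_of_def)
      ultimately show ?thesis using small[OF _ p(2)] by simp
    qed
    then show "\<exists>\<gamma>. gauge \<gamma> \<and> (\<forall>\<D>. \<D> tagged_division_of cbox a b \<and> \<gamma> fine \<D> \<longrightarrow>
        norm ((\<Sum>(x, k)\<in>\<D>. measure lborel k *\<^sub>R \<bar>f x\<bar>) - 0) < e)"
      by (intro exI[of _ \<gamma>] conjI \<gamma> allI impI) (elim conjE)
  qed
  moreover have fa: "set_integrable lebesgue (cbox a b) (\<lambda>x. \<bar>f x\<bar>)"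
    using set_integrable_norm[OF f] by simp
  ultimately have "(LINT x:cbox a b|lebesgue. \<bar>f x\<bar>) = 0"
    using set_lebesgue_integral_eq_integral(2)[OF fa] by (simp add: integral_unique)
  then have "AE x in lebesgue. indicator (cbox a b) x *\<^sub>R \<bar>f x\<bar> = 0"
    using fa unfolding set_lebesgue_integral_def set_integrable_def
    by (subst (asm) integral_nonneg_eq_0_iff_AE) auto
  then show ?thesis by eventually_elim (auto simp: indicator_def split: if_splits)
qed

text \<open>
  The spaces on \<open>S\<close> are those of the restricted measure, to which the general theory above applies.
\<close>

lemma L2_eq_sq_integrable:
  assumes "S \<in> sets lebesgue"
  shows "L2 S = sq_integrable (lebesgue_on S)"
  using assms unfolding L2_def sq_integrable_def set_borel_measurable_def set_integrable_def
  by (simp add: borel_measurable_restrict_space_iff integrable_restrict_space)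

lemma L2_inner_eq_int_inner:
  assumes "S \<in> sets lebesgue"
  shows "L2_inner S u v = int_inner (lebesgue_on S) u v"
  using assms unfolding L2_inner_def int_inner_def set_lebesgue_integral_def
  by (simp add: integral_restrict_space)

lemma AE_on_iff:
  assumes "S \<in> sets lebesgue"
  shows "(AE x\<in>S in lebesgue. P x) \<longleftrightarrow> (AE x in lebesgue_on S. P x)"
  using assms by (simp add: AE_restrict_space_iff)

text \<open>
  Serves both kinds of functions that occur in integration by parts: test functions, with \<open>K\<close> their
  support, and periodic functions on an open box, with \<open>K\<close> the closed box.
\<close>

lemma continuous_compact_support_L2:
  fixes h :: "real^'d::finite \<Rightarrow> real"
  assumes h: "continuous_on UNIV h" and K: "compact K" and S: "S \<in> sets lebesgue"
    and out: "\<And>x. x \<in> S \<Longrightarrow> x \<notin> K \<Longrightarrow> h x = 0"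
  shows "h \<in> L2 S"
proof -
  have hm: "h \<in> borel_measurable lebesgue"
    using h by (intro measurable_completion) (auto intro: borel_measurable_continuous_onI)
  have "integrable lborel (\<lambda>x. indicator K x *\<^sub>R (norm (h x))\<^sup>2)"
    by (intro borel_integrable_compact K continuous_intros continuous_on_subset[OF h]) auto
  then have "set_integrable lebesgue K (\<lambda>x. (norm (h x))\<^sup>2)"
    unfolding set_integrable_def using h K
    by (subst integrable_completion)
       (auto intro!: borel_measurable_times borel_measurable_power borel_measurable_continuous_onI)
  then have "set_integrable lebesgue (S \<inter> K) (\<lambda>x. (norm (h x))\<^sup>2)"
    by (rule set_integrable_subset) (use S fmeasurableD[OF lmeasurable_compact[OF K]] in auto)
  moreover have "(\<lambda>x. indicator (S \<inter> K) x *\<^sub>R (norm (h x))\<^sup>2) = (\<lambda>x. indicator S x *\<^sub>R (norm (h x))\<^sup>2)"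
    using out by (auto simp: indicator_def fun_eq_iff)
  ultimately have "set_integrable lebesgue S (\<lambda>x. (norm (h x))\<^sup>2)"
    by (simp add: set_integrable_def)
  then show ?thesis
    using hm S by (auto simp: L2_def set_borel_measurable_def)
qed

lemma C_infinity_continuous:
  assumes "\<eta> \<in> C_infinity"
  shows "continuous_on UNIV \<eta>" "continuous_on UNIV (partial_deriv i \<eta>)"
proof -
  have C: "C_k k \<eta>" for k using assms by (simp add: C_infinity_def)
  show "continuous_on UNIV \<eta>" using C[of 0] by simp
  show "continuous_on UNIV (partial_deriv i \<eta>)" using C[of "Suc 0"] by simp
qed

lemma partial_deriv_0_outside_support:
  assumes "x \<notin> closure {x. \<eta> x \<noteq> 0}"
  shows "partial_deriv i \<eta> x = 0"
proof -
  have "((\<lambda>x. 0) has_derivative (\<lambda>h. 0)) (at x)" by simp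
  then have "(\<eta> has_derivative (\<lambda>h. 0)) (at x)"
    by (rule has_derivative_transform_within_open[of _ _ _ _ "- closure {x. \<eta> x \<noteq> 0}"])
       (use assms closure_subset[of "{x. \<eta> x \<noteq> 0}"] in auto)
  then show ?thesis by (rule partial_deriv_eqI)
qed

lemma test_function_L2:
  assumes "S \<in> sets lebesgue" "\<eta> \<in> test_functions \<Omega>"
  shows "\<eta> \<in> L2 S" "partial_deriv i \<eta> \<in> L2 S"
proof -
  have \<eta>: "\<eta> \<in> C_infinity" "compact (closure {x. \<eta> x \<noteq> 0})"
    using assms by (auto simp: test_functions_def)
  show "\<eta> \<in> L2 S"
    by (rule continuous_compact_support_L2[OF C_infinity_continuous(1)[OF \<eta>(1)] \<eta>(2) assms(1)])
       (use closure_subset[of "{x. \<eta> x \<noteq> 0}"] in blast)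
  show "partial_deriv i \<eta> \<in> L2 S"
    by (rule continuous_compact_support_L2[OF C_infinity_continuous(2)[OF \<eta>(1)] \<eta>(2) assms(1)])
       (rule partial_deriv_0_outside_support)
qed

lemma periodic_smooth_L2:
  assumes "\<eta> \<in> periodic_smooth a b"
  shows "\<eta> \<in> L2 (box a b)" "partial_deriv i \<eta> \<in> L2 (box a b)"
proof -
  have \<eta>: "\<eta> \<in> C_infinity" using assms by (auto simp: periodic_smooth_def)
  have out: "x \<in> box a b \<Longrightarrow> x \<notin> cbox a b \<Longrightarrow> P" for x P
    using box_subset_cbox[of a b] by blast
  show "\<eta> \<in> L2 (box a b)"
    by (rule continuous_compact_support_L2[OF C_infinity_continuous(1)[OF \<eta>] compact_cbox _ out]) simp_all
  show "partial_deriv i \<eta> \<in> L2 (box a b)"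
    by (rule continuous_compact_support_L2[OF C_infinity_continuous(2)[OF \<eta>] compact_cbox _ out]) simp_all
qed

text \<open>
  The bumps converge to the indicator of the open box and are bounded by that of the closed box, on
  which \<open>g\<close> is integrable, so dominated convergence applies. Faces of the box are null sets.
\<close>

lemma integral_box_eq_0:
  fixes g :: "real^'d::finite \<Rightarrow> real"
  assumes S: "open S" and g: "g \<in> L2 S" and sub: "cbox a b \<subseteq> S"
    and orth: "\<And>\<eta>. \<eta> \<in> test_functions S \<Longrightarrow> L2_inner S g \<eta> = 0"
  shows "set_integrable lebesgue (cbox a b) g" "integral (cbox a b) g = 0"
proof -
  have box_sets: "cbox a b \<in> sets lebesgue" "box a b \<in> sets lebesgue"
    by (auto intro: fmeasurableD lmeasurable_cbox lmeasurable_box)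
  have gm: "(\<lambda>x. indicator S x * g x) \<in> borel_measurable lebesgue"
    using g by (simp add: L2_def set_borel_measurable_def)
  have "set_integrable lebesgue S (\<lambda>x. (g x)\<^sup>2)"
    using g by (simp add: L2_def)
  then have g2: "set_integrable lebesgue (cbox a b) (\<lambda>x. (g x)\<^sup>2)"
    by (rule set_integrable_subset) (use sub box_sets in auto)
  have gmc: "(\<lambda>x. indicator (cbox a b) x * g x) \<in> borel_measurable lebesgue"
  proof -
    have "(\<lambda>x. indicator (cbox a b) x * (indicator S x * g x)) \<in> borel_measurable lebesgue"
      by (intro borel_measurable_times[OF _ gm] borel_measurable_indicator box_sets)
    also have "(\<lambda>x. indicator (cbox a b) x * (indicator S x * g x)) = (\<lambda>x. indicator (cbox a b) x * g x)"
      using sub by (auto simp: indicator_def fun_eq_iff)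
    finally show ?thesis .
  qed
  have one: "set_integrable lebesgue (cbox a b) (\<lambda>x. 1::real)"
    using lmeasurable_cbox[of a b] by (simp add: set_integrable_def lmeasurable_iff_integrable)
  show gi: "set_integrable lebesgue (cbox a b) g"
    unfolding set_integrable_def
  proof (rule Bochner_Integration.integrable_bound[OF set_integral_add(1)[OF g2 one, unfolded set_integrable_def]])
    show "(\<lambda>x. indicator (cbox a b) x *\<^sub>R g x) \<in> borel_measurable lebesgue" using gmc by simp
    have "\<bar>t\<bar> \<le> t\<^sup>2 + 1" for t :: real
    proof -
      have "0 \<le> (\<bar>t\<bar> - 1)\<^sup>2" by simp
      then show ?thesis unfolding power2_diff power2_abs using abs_ge_zero[of t] by simp
    qed
    then show "AE x in lebesgue. norm (indicator (cbox a b) x *\<^sub>R g x) \<le> norm (indicator (cbox a b) x *\<^sub>R ((g x)\<^sup>2 + 1))"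
      by (auto simp: indicator_def)
  qed
  have "(\<lambda>k. \<integral>x. box_bump a b k x * (indicator (cbox a b) x * g x) \<partial>lebesgue)
      \<longlonglongrightarrow> (\<integral>x. indicator (box a b) x * (indicator (cbox a b) x * g x) \<partial>lebesgue)"
  proof (rule integral_dominated_convergence[where w = "\<lambda>x. norm (indicator (cbox a b) x *\<^sub>R g x)"])
    show "integrable lebesgue (\<lambda>x. norm (indicator (cbox a b) x *\<^sub>R g x))"
      using gi by (auto simp: set_integrable_def)
    show "(\<lambda>x. indicator (box a b) x * (indicator (cbox a b) x * g x)) \<in> borel_measurable lebesgue"
      by (intro borel_measurable_times[OF _ gmc] borel_measurable_indicator box_sets)
    show "(\<lambda>x. box_bump a b k x * (indicator (cbox a b) x * g x)) \<in> borel_measurable lebesgue" for k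
      using C_infinity_continuous(1)[OF box_bump_C_infinity[of a b k]]
      by (intro borel_measurable_times[OF measurable_completion gmc]) (auto intro: borel_measurable_continuous_onI)
    show "AE x in lebesgue. (\<lambda>k. box_bump a b k x * (indicator (cbox a b) x * g x))
        \<longlonglongrightarrow> indicator (box a b) x * (indicator (cbox a b) x * g x)"
      by (intro AE_I2 tendsto_intros box_bump_tendsto)
    show "AE x in lebesgue. norm (box_bump a b k x * (indicator (cbox a b) x * g x)) \<le> norm (indicator (cbox a b) x *\<^sub>R g x)" for k
    proof (intro AE_I2)
      fix x
      have "\<bar>box_bump a b k x\<bar> * \<bar>indicator (cbox a b) x * g x\<bar> \<le> 1 * \<bar>indicator (cbox a b) x * g x\<bar>"
        using box_bump_bounds[of a b k x] by (intro mult_right_mono) auto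
      then show "norm (box_bump a b k x * (indicator (cbox a b) x * g x)) \<le> norm (indicator (cbox a b) x *\<^sub>R g x)"
        by (simp add: abs_mult)
    qed
  qed
  moreover have "(\<integral>x. box_bump a b k x * (indicator (cbox a b) x * g x) \<partial>lebesgue) = 0" for k
  proof -
    have "(\<integral>x. box_bump a b k x * (indicator (cbox a b) x * g x) \<partial>lebesgue) = L2_inner S g (box_bump a b k)"
      unfolding L2_inner_def set_lebesgue_integral_def
    proof (intro Bochner_Integration.integral_cong refl)
      fix x
      show "box_bump a b k x * (indicator (cbox a b) x * g x) = indicator S x *\<^sub>R (g x \<bullet> box_bump a b k x)"
        using sub box_bump_outside[of x a b k] box_subset_cbox[of a b] by (auto simp: indicator_def)
    qed
    then show ?thesis using orth[OF box_bump_test_function[OF sub]] by simp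
  qed
  ultimately have "(\<integral>x. indicator (box a b) x * (indicator (cbox a b) x * g x) \<partial>lebesgue) = 0"
    by (simp add: LIMSEQ_const_iff)
  also have "(\<lambda>x. indicator (box a b) x * (indicator (cbox a b) x * g x)) = (\<lambda>x. indicator (box a b) x *\<^sub>R g x)"
    using box_subset_cbox[of a b] by (auto simp: indicator_def fun_eq_iff)
  finally have "(LINT x:box a b|lebesgue. g x) = 0"
    by (simp add: set_lebesgue_integral_def)
  moreover have "set_integrable lebesgue (box a b) g"
    by (rule set_integrable_subset[OF gi box_sets(2) box_subset_cbox])
  ultimately show "integral (cbox a b) g = 0"
    using set_lebesgue_integral_eq_integral(2)[of "box a b" g] by (simp add: integral_open_interval)
qed

text \<open>
  An open set is a countable union of closed boxes, and on each of them \<open>g\<close> has vanishing integrals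
  over all smaller boxes.
\<close>

lemma fundamental_lemma:
  fixes g :: "real^'d::finite \<Rightarrow> real"
  assumes S: "open S" and g: "g \<in> L2 S"
    and orth: "\<And>\<eta>. \<eta> \<in> test_functions S \<Longrightarrow> L2_inner S g \<eta> = 0"
  shows "AE x\<in>S in lebesgue. g x = 0"
proof -
  obtain \<D> where D: "countable \<D>" "\<D> \<subseteq> Pow S" "\<And>X. X \<in> \<D> \<Longrightarrow> \<exists>a b. X = cbox a b" "\<Union>\<D> = S"
    using open_countable_Union_open_cbox[OF S] by blast
  have "AE x\<in>X in lebesgue. g x = 0" if X: "X \<in> \<D>" for X
  proof -
    obtain a b where ab: "X = cbox a b" "cbox a b \<subseteq> S" using D X by blast
    note box0 = integral_box_eq_0[OF S g _ orth]
    have "integral (cbox c d) g = 0" if "cbox c d \<subseteq> cbox a b" for c d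
      by (rule box0(2)) (use ab(2) that in blast)
    then show ?thesis unfolding ab(1)
      by (intro zero_integrals_imp_AE_zero box0(1)[OF ab(2)])
  qed
  then have "AE x in lebesgue. \<forall>X\<in>\<D>. x \<in> X \<longrightarrow> g x = 0"
    by (subst AE_ball_countable[OF D(1)]) auto
  then show ?thesis by eventually_elim (use D(4) in auto)
qed

section \<open>Function spaces with a weak gradient\<close>

lemma weak_grad_AE_unique:
  assumes S: "open S" and g: "g \<in> L2 S" "is_weak_grad S u g" and h: "h \<in> L2 S" "is_weak_grad S u h"
  shows "AE x\<in>S in lebesgue. g x = h x"
proof -
  have Sl: "S \<in> sets lebesgue" using S by auto
  note [simp] = L2_eq_sq_integrable[OF Sl] L2_inner_eq_int_inner[OF Sl]
  have "AE x\<in>S in lebesgue. g x $ i - h x $ i = 0" for i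
  proof (rule fundamental_lemma[OF S])
    have comp: "(\<lambda>x. g x $ i) \<in> sq_integrable (lebesgue_on S)" "(\<lambda>x. h x $ i) \<in> sq_integrable (lebesgue_on S)"
      using g(1) h(1) by (auto intro: sq_integrable_bounded_linear[OF bounded_linear_vec_nth])
    then show "(\<lambda>x. g x $ i - h x $ i) \<in> L2 S" by (simp add: sq_integrable_diff)
    fix \<eta> assume \<eta>: "\<eta> \<in> test_functions S"
    then have "\<eta> \<in> sq_integrable (lebesgue_on S)" using test_function_L2(1)[OF Sl] by simp
    then have "L2_inner S (\<lambda>x. g x $ i - h x $ i) \<eta> = L2_inner S (\<lambda>x. g x $ i) \<eta> - L2_inner S (\<lambda>x. h x $ i) \<eta>"
      by (simp add: int_inner_diff[OF comp])
    moreover have "L2_inner S (\<lambda>x. g x $ i) \<eta> = L2_inner S (\<lambda>x. h x $ i) \<eta>"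
      using g(2)[unfolded is_weak_grad_def, rule_format, OF \<eta>, of i]
        h(2)[unfolded is_weak_grad_def, rule_format, OF \<eta>, of i] by simp
    ultimately show "L2_inner S (\<lambda>x. g x $ i - h x $ i) \<eta> = 0" by simp
  qed
  then have "AE x in lebesgue. \<forall>i. x \<in> S \<longrightarrow> g x $ i - h x $ i = 0"
    unfolding AE_all_countable by simp
  then show ?thesis by eventually_elim (auto simp: vec_eq_iff)
qed

text \<open>
  With \<open>P\<close> the test functions this is the defining property of the weak gradient; enlarging \<open>P\<close> by the
  periodic functions encodes the periodic boundary condition. The two boundary conditions thus
  become two instances of one notion.
\<close>

definition int_by_parts :: "(real^'d::finite \<Rightarrow> real) set \<Rightarrow> (real^'d) set \<Rightarrow> (real^'d \<Rightarrow> real) \<Rightarrow> (real^'d \<Rightarrow> real^'d) \<Rightarrow> bool" where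
  "int_by_parts P S u g \<longleftrightarrow> (\<forall>\<eta>\<in>P. \<forall>i. L2_inner S u (partial_deriv i \<eta>) = - L2_inner S (\<lambda>x. g x $ i) \<eta>)"

text \<open>
  Common ground of \<open>H\<^sup>1\<close> and its periodic subspace: all that matters about the functions in \<open>P\<close> is that they and
  their partial derivatives are square integrable and that they determine the weak gradient.
\<close>

locale grad_space =
  fixes S :: "(real^'d::finite) set" and P :: "(real^'d \<Rightarrow> real) set" and V :: "(real^'d \<Rightarrow> real) set"
  assumes S: "open S"
    and P_L2: "\<And>\<eta> i. \<eta> \<in> P \<Longrightarrow> \<eta> \<in> L2 S \<and> partial_deriv i \<eta> \<in> L2 S"
    and P_test: "test_functions S \<subseteq> P"
    and V_eq: "V = {u \<in> L2 S. \<exists>g\<in>L2 S. int_by_parts P S u g}"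
begin

abbreviation N where "N \<equiv> lebesgue_on S"

lemma Sl: "S \<in> sets lebesgue"
  using S by auto

lemmas sq = L2_eq_sq_integrable[OF Sl] L2_inner_eq_int_inner[OF Sl] AE_on_iff[OF Sl]

lemma P_sq: "\<eta> \<in> P \<Longrightarrow> \<eta> \<in> sq_integrable N" "\<eta> \<in> P \<Longrightarrow> partial_deriv i \<eta> \<in> sq_integrable N"
  using P_L2 by (auto simp: sq)

lemma nth_sq: "g \<in> sq_integrable N \<Longrightarrow> (\<lambda>x. g x $ i) \<in> sq_integrable N"
  by (rule sq_integrable_bounded_linear[OF bounded_linear_vec_nth])

lemma int_by_parts_weak: "int_by_parts P S u g \<Longrightarrow> is_weak_grad S u g"
  using P_test by (auto simp: int_by_parts_def is_weak_grad_def)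

lemma weak_grad_unique:
  assumes g: "g \<in> sq_integrable N" "int_by_parts P S u g"
  shows "weak_grad S u \<in> sq_integrable N" "AE x in N. weak_grad S u x = g x"
proof -
  have "weak_grad S u \<in> L2 S \<and> is_weak_grad S u (weak_grad S u)"
    unfolding weak_grad_def by (rule someI[of _ g]) (use g int_by_parts_weak in \<open>auto simp: sq\<close>)
  then show "weak_grad S u \<in> sq_integrable N" "AE x in N. weak_grad S u x = g x"
    using weak_grad_AE_unique[OF S _ _ _ int_by_parts_weak[OF g(2)]] g by (auto simp: sq)
qed

lemma int_by_parts_cong_AE:
  assumes "int_by_parts P S u g" "g \<in> sq_integrable N" "h \<in> sq_integrable N" "AE x in N. g x = h x"
  shows "int_by_parts P S u h"
proof -
  have "int_inner N (\<lambda>x. g x $ i) \<eta> = int_inner N (\<lambda>x. h x $ i) \<eta>" if "\<eta> \<in> P" for \<eta> i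
  proof (rule int_inner_cong_AE)
    show "AE x in N. g x $ i = h x $ i" using assms(4) by eventually_elim simp
  qed (simp_all add: sq_integrable_measurable nth_sq P_sq assms that)
  then show ?thesis using assms(1) by (simp add: int_by_parts_def sq)
qed

lemma V_iff: "u \<in> V \<longleftrightarrow> u \<in> sq_integrable N \<and> weak_grad S u \<in> sq_integrable N \<and> int_by_parts P S u (weak_grad S u)"
proof
  assume "u \<in> V"
  then obtain g where g: "u \<in> sq_integrable N" "g \<in> sq_integrable N" "int_by_parts P S u g" by (auto simp: V_eq sq)
  note w = weak_grad_unique[OF g(2,3)]
  have "int_by_parts P S u (weak_grad S u)"
    using w(2) by (intro int_by_parts_cong_AE[OF g(3,2) w(1)]) (simp add: eq_commute)
  with g w show "u \<in> sq_integrable N \<and> weak_grad S u \<in> sq_integrable N \<and> int_by_parts P S u (weak_grad S u)" by simp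
qed (auto simp: V_eq sq)

lemma V_lincomb:
  assumes "u \<in> V" "v \<in> V"
  shows "(\<lambda>x. c * u x + d * v x) \<in> V"
    and "AE x in N. weak_grad S (\<lambda>x. c * u x + d * v x) x = c *\<^sub>R weak_grad S u x + d *\<^sub>R weak_grad S v x"
proof -
  define g where "g x = c *\<^sub>R weak_grad S u x + d *\<^sub>R weak_grad S v x" for x
  have u: "u \<in> sq_integrable N" "weak_grad S u \<in> sq_integrable N" "int_by_parts P S u (weak_grad S u)"
    and v: "v \<in> sq_integrable N" "weak_grad S v \<in> sq_integrable N" "int_by_parts P S v (weak_grad S v)"
    using assms by (auto simp: V_iff)
  have g: "g \<in> sq_integrable N" unfolding g_def by (rule sq_integrable_lincomb[OF u(2) v(2)])
  have w: "(\<lambda>x. c * u x + d * v x) \<in> sq_integrable N" using sq_integrable_lincomb[OF u(1) v(1), of c d] by simp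
  have i: "int_by_parts P S (\<lambda>x. c * u x + d * v x) g"
    unfolding int_by_parts_def
  proof (intro ballI allI)
    fix \<eta> i assume \<eta>: "\<eta> \<in> P"
    show "L2_inner S (\<lambda>x. c * u x + d * v x) (partial_deriv i \<eta>) = - L2_inner S (\<lambda>x. g x $ i) \<eta>"
      using u(3) v(3) \<eta> int_inner_lincomb[OF u(1) v(1) P_sq(2)[OF \<eta>], where c = c and d = d]
        int_inner_lincomb[OF nth_sq[OF u(2)] nth_sq[OF v(2)] P_sq(1)[OF \<eta>], where c = c and d = d]
      by (simp add: g_def sq int_by_parts_def)
  qed
  show "(\<lambda>x. c * u x + d * v x) \<in> V" using w g i by (auto simp: V_eq sq)
  show "AE x in N. weak_grad S (\<lambda>x. c * u x + d * v x) x = c *\<^sub>R weak_grad S u x + d *\<^sub>R weak_grad S v x"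
    using weak_grad_unique(2)[OF g i] unfolding g_def .
qed

text \<open>
  Both sides of the integration by parts formula are continuous in mean square for a fixed function
  in \<open>P\<close>.
\<close>

lemma V_closed:
  assumes f: "\<And>n. f n \<in> V" and u: "u \<in> sq_integrable N" and g: "g \<in> sq_integrable N"
    and lim_u: "(\<lambda>n. dist_sq N (f n) u) \<longlonglongrightarrow> 0"
    and lim_g: "(\<lambda>n. dist_sq N (weak_grad S (f n)) g) \<longlonglongrightarrow> 0"
  shows "u \<in> V" "AE x in N. weak_grad S u x = g x"
proof -
  have fs: "f n \<in> sq_integrable N" "weak_grad S (f n) \<in> sq_integrable N" "int_by_parts P S (f n) (weak_grad S (f n))" for n
    using f[of n] by (auto simp: V_iff)
  have i: "int_by_parts P S u g"
    unfolding int_by_parts_def sq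
  proof (intro ballI allI)
    fix \<eta> i assume \<eta>: "\<eta> \<in> P"
    have "(\<lambda>n. int_inner N (f n) (partial_deriv i \<eta>)) \<longlonglongrightarrow> int_inner N u (partial_deriv i \<eta>)"
      by (rule int_inner_tendsto[OF fs(1) u P_sq(2)[OF \<eta>] lim_u])
    moreover have "(\<lambda>n. - int_inner N (\<lambda>x. weak_grad S (f n) x $ i) \<eta>) \<longlonglongrightarrow> - int_inner N (\<lambda>x. g x $ i) \<eta>"
      by (intro tendsto_minus int_inner_tendsto nth_sq fs g P_sq \<eta>
            dist_sq_tendsto_bounded_linear[OF bounded_linear_vec_nth] lim_g)
    moreover have "int_inner N (f n) (partial_deriv i \<eta>) = - int_inner N (\<lambda>x. weak_grad S (f n) x $ i) \<eta>" for n
      using fs(3)[of n] \<eta> by (simp add: int_by_parts_def sq)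
    ultimately show "int_inner N u (partial_deriv i \<eta>) = - int_inner N (\<lambda>x. g x $ i) \<eta>"
      by (simp add: LIMSEQ_unique)
  qed
  show "u \<in> V" using u g i by (auto simp: V_eq sq)
  show "AE x in N. weak_grad S u x = g x" by (rule weak_grad_unique(2)[OF g i])
qed

end


lemma int_by_parts_Un: "int_by_parts (P \<union> Q) S u g \<longleftrightarrow> int_by_parts P S u g \<and> int_by_parts Q S u g"
  by (auto simp: int_by_parts_def)

lemma grad_space_H1:
  assumes "open S"
  shows "grad_space S (test_functions S) (H1 S)"
proof
  show "\<eta> \<in> L2 S \<and> partial_deriv i \<eta> \<in> L2 S" if "\<eta> \<in> test_functions S" for \<eta> i
    using test_function_L2[OF _ that] assms by auto
qed (auto simp: assms H1_def int_by_parts_def is_weak_grad_def)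

text \<open>
  The definition of the periodic space refers to the chosen weak gradient, whereas the locale asks
  for some gradient. By uniqueness the two agree, which is what \<open>V_iff\<close> expresses.
\<close>

lemma grad_space_H1_per:
  "grad_space (box a b) (test_functions (box a b) \<union> periodic_smooth a b) (H1_per a b)"
proof -
  let ?P = "test_functions (box a b) \<union> periodic_smooth a b"
  interpret H1: grad_space "box a b" "test_functions (box a b)" "H1 (box a b)"
    by (rule grad_space_H1) (rule open_box)
  interpret per: grad_space "box a b" ?P "{u \<in> L2 (box a b). \<exists>g\<in>L2 (box a b). int_by_parts ?P (box a b) u g}"
    by unfold_locales (use H1.P_L2 periodic_smooth_L2 in auto)
  have "H1_per a b = {u \<in> H1 (box a b). int_by_parts (periodic_smooth a b) (box a b) u (weak_grad (box a b) u)}"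
    by (simp add: H1_per_def int_by_parts_def)
  also have "\<dots> = {u \<in> L2 (box a b). \<exists>g\<in>L2 (box a b). int_by_parts ?P (box a b) u g}"
    using H1.V_iff per.V_iff by (auto simp: int_by_parts_Un)
  finally show ?thesis using per.grad_space_axioms by simp
qed

section \<open>The energy form on the graph space\<close>

text \<open>
  The numbers \<open>c\<close>, \<open>e\<close>, \<open>k\<close> stand for square roots of the weights of the three terms of the form.
\<close>

locale energy_space = grad_space S P V
  for S :: "(real^'d::finite) set" and P V +
  fixes H :: "real^'d \<Rightarrow> real" and c e k :: real
  assumes c: "c > 0" and e: "e > 0"
    and H: "\<And>\<psi>. \<psi> \<in> V \<Longrightarrow> (\<lambda>x. H x * \<psi> x) \<in> L2 S"
begin

definition graph :: "(real^'d \<Rightarrow> real) \<Rightarrow> real^'d \<Rightarrow> real \<times> (real^'d) \<times> real" where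
  "graph \<phi> x = (c *\<^sub>R \<phi> x, e *\<^sub>R weak_grad S \<phi> x, k *\<^sub>R (H x * \<phi> x))"

lemma V_sq: "u \<in> V \<Longrightarrow> u \<in> sq_integrable N" "u \<in> V \<Longrightarrow> weak_grad S u \<in> sq_integrable N"
  "u \<in> V \<Longrightarrow> (\<lambda>x. H x * u x) \<in> sq_integrable N"
  using H by (auto simp: V_iff sq)

lemma graph_sq: "u \<in> V \<Longrightarrow> graph u \<in> sq_integrable N"
  unfolding graph_def[abs_def] by (intro sq_integrable_Pair sq_integrable_scale V_sq)

lemma int_inner_graph:
  assumes "u \<in> V" "v \<in> V"
  shows "int_inner N (graph u) (graph v) = c\<^sup>2 * int_inner N u v + e\<^sup>2 * int_inner N (weak_grad S u) (weak_grad S v)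
    + k\<^sup>2 * int_inner N (\<lambda>x. H x * u x) (\<lambda>x. H x * v x)"
  using assms unfolding graph_def[abs_def]
  by (simp only: int_inner_Pair int_inner_scale sq_integrable_Pair sq_integrable_scale V_sq)
     (simp add: power2_eq_square algebra_simps)

lemma graph_lincomb:
  assumes "u \<in> V" "v \<in> V"
  shows "AE x in N. graph (\<lambda>x. a * u x + b * v x) x = a *\<^sub>R graph u x + b *\<^sub>R graph v x"
  using V_lincomb(2)[OF assms, of a b]
  by eventually_elim (simp add: graph_def algebra_simps)

text \<open>
  Conversely to the evident direction, a function that vanishes almost everywhere has the zero field as a
  weak gradient, and by uniqueness the chosen one vanishes almost everywhere as well.
\<close>

lemma graph_eq_0_iff:
  assumes "u \<in> V"
  shows "(AE x in N. graph u x = 0) \<longleftrightarrow> (AE x in N. u x = 0)"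
proof
  assume "AE x in N. graph u x = 0"
  then show "AE x in N. u x = 0"
    by eventually_elim (use c in \<open>auto simp: graph_def zero_prod_def\<close>)
next
  assume u: "AE x in N. u x = 0"
  have "int_by_parts P S u (\<lambda>x. 0)"
    unfolding int_by_parts_def sq
  proof (intro ballI allI)
    fix \<eta> i
    have "int_inner N u (partial_deriv i \<eta>) = 0"
      unfolding int_inner_def
    proof (rule integral_eq_zero_AE)
      show "AE x in N. u x \<bullet> partial_deriv i \<eta> x = 0" using u by eventually_elim simp
    qed
    then show "int_inner N u (partial_deriv i \<eta>) = - int_inner N (\<lambda>x. 0 $ i) \<eta>"
      by (simp add: int_inner_def)
  qed
  then have "AE x in N. weak_grad S u x = 0"
    by (intro weak_grad_unique(2)) (auto simp: sq_integrable_def)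
  with u show "AE x in N. graph u x = 0"
    by eventually_elim (simp add: graph_def zero_prod_def)
qed

text \<open>
  Saturated under equality almost everywhere, because \<open>graph\<close> is linear only up to null sets while the
  projection theorem asks for a genuine linear subspace.
\<close>

definition graph_range where
  "graph_range = {w \<in> sq_integrable N. \<exists>u\<in>V. AE x in N. w x = graph u x}"

lemma graph_range_lincomb:
  assumes "w1 \<in> graph_range" "w2 \<in> graph_range"
  shows "(\<lambda>x. a *\<^sub>R w1 x + b *\<^sub>R w2 x) \<in> graph_range"
proof -
  obtain u1 u2 where u: "u1 \<in> V" "u2 \<in> V" and
    ae: "AE x in N. w1 x = graph u1 x" "AE x in N. w2 x = graph u2 x"
    using assms by (auto simp: graph_range_def)
  have "AE x in N. a *\<^sub>R w1 x + b *\<^sub>R w2 x = graph (\<lambda>x. a * u1 x + b * u2 x) x"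
    using ae graph_lincomb[OF u, of a b] by eventually_elim simp
  then show ?thesis
    using assms V_lincomb(1)[OF u] unfolding graph_range_def by (auto intro!: sq_integrable_lincomb)
qed

text \<open>
  The first two components of the limit determine \<open>u\<close> and its weak gradient. For the third component,
  convergence almost everywhere of a subsequence shows that multiplication by \<open>H\<close> commutes with
  the limit although \<open>H\<close> may be unbounded.
\<close>

lemma graph_range_closed:
  assumes f: "\<And>n. f n \<in> graph_range" and w: "w \<in> sq_integrable N" and lim: "(\<lambda>n. dist_sq N (f n) w) \<longlonglongrightarrow> 0"
  shows "w \<in> graph_range"
proof -
  have "\<forall>n. \<exists>u. u \<in> V \<and> (AE x in N. f n x = graph u x)"
    using f by (auto simp: graph_range_def)
  then obtain \<phi> where \<phi>: "\<And>n. \<phi> n \<in> V" and ae: "\<And>n. AE x in N. f n x = graph (\<phi> n) x"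
    by metis
  have fs: "f n \<in> sq_integrable N" for n using f by (simp add: graph_range_def)
  note graph_s = graph_sq[OF \<phi>]
  have "dist_sq N (f n) w = dist_sq N (graph (\<phi> n)) w" for n
  proof (rule int_inner_cong_AE)
    show ae': "AE x in N. f n x - w x = graph (\<phi> n) x - w x" using ae[of n] by eventually_elim simp
    show "AE x in N. f n x - w x = graph (\<phi> n) x - w x" by (rule ae')
  qed (intro sq_integrable_measurable sq_integrable_diff fs graph_s w)+
  with lim have lim_graph: "(\<lambda>n. dist_sq N (graph (\<phi> n)) w) \<longlonglongrightarrow> 0" by simp
  define u where "u x = (1 / c) *\<^sub>R fst (w x)" for x
  define g where "g x = (1 / e) *\<^sub>R fst (snd (w x))" for x
  have b1: "bounded_linear (\<lambda>p::real \<times> (real^'d) \<times> real. (1 / c) *\<^sub>R fst p)"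
    by (intro bounded_linear_scaleR_right[THEN bounded_linear_compose] bounded_linear_fst)
  have b2: "bounded_linear (\<lambda>p::real \<times> (real^'d) \<times> real. (1 / e) *\<^sub>R fst (snd p))"
    by (intro bounded_linear_scaleR_right[THEN bounded_linear_compose]
        bounded_linear_fst[THEN bounded_linear_compose] bounded_linear_snd)
  have u: "u \<in> sq_integrable N" unfolding u_def by (rule sq_integrable_bounded_linear[OF b1 w])
  have g: "g \<in> sq_integrable N" unfolding g_def by (rule sq_integrable_bounded_linear[OF b2 w])
  have lim_u: "(\<lambda>n. dist_sq N (\<phi> n) u) \<longlonglongrightarrow> 0"
    using dist_sq_tendsto_bounded_linear[OF b1 graph_s w lim_graph] c by (simp add: graph_def u_def)
  have lim_g: "(\<lambda>n. dist_sq N (weak_grad S (\<phi> n)) g) \<longlonglongrightarrow> 0"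
    using dist_sq_tendsto_bounded_linear[OF b2 graph_s w lim_graph] e by (simp add: graph_def g_def)
  note V = V_closed[OF \<phi> u g lim_u lim_g]
  obtain r :: "nat \<Rightarrow> nat" where "AE x in N. (\<lambda>n. graph (\<phi> (r n)) x) \<longlonglongrightarrow> w x"
    by (rule sq_integrable_tendsto_AE_subseq[OF graph_s w lim_graph])
  with V(2) have "AE x in N. w x = graph u x"
  proof eventually_elim
    case (elim x)
    have "(\<lambda>n. c * \<phi> (r n) x) \<longlonglongrightarrow> fst (w x)"
      using tendsto_fst[OF elim(2)] by (simp add: graph_def)
    then have "(\<lambda>n. (k * H x / c) * (c * \<phi> (r n) x)) \<longlonglongrightarrow> (k * H x / c) * fst (w x)"
      by (intro tendsto_intros)
    then have "(\<lambda>n. k * (H x * \<phi> (r n) x)) \<longlonglongrightarrow> k * (H x * u x)"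
      using c by (simp add: u_def algebra_simps)
    moreover have "(\<lambda>n. k * (H x * \<phi> (r n) x)) \<longlonglongrightarrow> snd (snd (w x))"
      using tendsto_snd[OF tendsto_snd[OF elim(2)]] by (simp add: graph_def)
    ultimately have "snd (snd (w x)) = k * (H x * u x)" by (intro LIMSEQ_unique)
    moreover have "fst (w x) = c * u x" using c by (simp add: u_def)
    moreover have "fst (snd (w x)) = e *\<^sub>R weak_grad S u x" using elim(1) e by (simp add: g_def)
    ultimately show ?case by (simp add: graph_def prod_eq_iff)
  qed
  with V(1) w show ?thesis by (auto simp: graph_range_def)
qed

text \<open>
  The function \<open>u\<close> is a preimage of the projection of \<open>G\<close> to the closed subspace \<open>graph_range\<close>.
\<close>

lemma ex_solution:
  assumes G: "G \<in> sq_integrable N" and ne: "V \<noteq> {}"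
  obtains u where "u \<in> V" "\<And>v. v \<in> V \<Longrightarrow> int_inner N (graph u) (graph v) = int_inner N G (graph v)"
proof -
  have in_range: "graph v \<in> graph_range" if "v \<in> V" for v using that by (auto simp: graph_range_def graph_sq)
  obtain v0 where "v0 \<in> V" using ne by blast
  then have ne: "graph_range \<noteq> {}" using in_range by blast
  have sub: "graph_range \<subseteq> sq_integrable N" unfolding graph_range_def by blast
  show thesis
  proof (rule projection_exists[OF ne sub graph_range_lincomb graph_range_closed G])
    fix w assume w: "w \<in> graph_range" "\<And>v. v \<in> graph_range \<Longrightarrow> int_inner N w v = int_inner N G v"
    obtain u where u: "u \<in> V" "AE x in N. w x = graph u x" and ws: "w \<in> sq_integrable N"
      using w(1) by (auto simp: graph_range_def)
    have "int_inner N (graph u) (graph v) = int_inner N G (graph v)" if v: "v \<in> V" for v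
    proof -
      have "int_inner N (graph u) (graph v) = int_inner N w (graph v)"
        by (rule int_inner_cong_AE) (use u(2) in \<open>simp_all add: sq_integrable_measurable graph_sq u(1) v ws eq_commute\<close>)
      then show ?thesis using w(2)[OF in_range[OF v]] by simp
    qed
    with u(1) show thesis by (rule that)
  qed
qed

lemma int_inner_graph_lincomb:
  assumes "u \<in> V" "v \<in> V" "w \<in> V"
  shows "int_inner N (graph (\<lambda>x. a * u x + b * v x)) (graph w) = a * int_inner N (graph u) (graph w) + b * int_inner N (graph v) (graph w)"
proof -
  have "int_inner N (graph (\<lambda>x. a * u x + b * v x)) (graph w) = int_inner N (\<lambda>x. a *\<^sub>R graph u x + b *\<^sub>R graph v x) (graph w)"
    by (rule int_inner_cong_AE)
       (simp_all add: sq_integrable_measurable graph_sq V_lincomb(1) sq_integrable_lincomb assms graph_lincomb)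
  then show ?thesis by (simp add: int_inner_lincomb graph_sq assms)
qed

lemma int_inner_graph_eq_0_iff:
  assumes "u \<in> V"
  shows "int_inner N (graph u) (graph u) = 0 \<longleftrightarrow> (AE x in N. u x = 0)"
  using int_inner_self_eq_0_iff[OF graph_sq[OF assms]] graph_eq_0_iff[OF assms] by simp

lemma solution_unique:
  assumes "u \<in> V" "u' \<in> V" and eq: "\<And>v. v \<in> V \<Longrightarrow> int_inner N (graph u') (graph v) = int_inner N (graph u) (graph v)"
  shows "AE x in N. u' x = u x"
proof -
  define w where "w x = 1 * u' x + (- 1) * u x" for x
  have w: "w \<in> V" unfolding w_def by (rule V_lincomb(1)) (rule assms)+
  have "int_inner N (graph w) (graph w) = 1 * int_inner N (graph u') (graph w) + (- 1) * int_inner N (graph u) (graph w)"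
    using int_inner_graph_lincomb[OF assms(2,1) w, of 1 "-1"] unfolding w_def .
  then have "int_inner N (graph w) (graph w) = 0" using eq[OF w] by simp
  then have "AE x in N. w x = 0" by (simp add: int_inner_graph_eq_0_iff[OF w])
  then show ?thesis by eventually_elim (simp add: w_def)
qed

end

section \<open>The time step\<close>

theorem theorem4p2:
  fixes \<Omega> :: "(real^'d::finite) set"
    and V :: "(real^'d \<Rightarrow> real) set"
    and M \<epsilon> \<delta>t A B :: real
    and D :: "real set"
    and F f :: "real \<Rightarrow> real"
    and \<phi>\<^sub>n U\<^sub>n H\<^sub>n :: "real^'d \<Rightarrow> real"
  assumes dim: "CARD('d) = 2 \<or> CARD('d) = 3"
    and domain: "open \<Omega>" "connected \<Omega>" "\<Omega> \<noteq> {}"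
    and boundary_condition: "V = H1 \<Omega> \<or> (\<exists>a b. \<Omega> = box a b \<and> V = H1_per a b)"
    and params: "M > 0" "\<epsilon> > 0" "\<delta>t > 0"
    and D: "open D"
    and F_bounded_below: "A > 0" "\<And>s. s \<in> D \<Longrightarrow> F s > - A"
    and B: "B > A"
    and f: "\<And>s. s \<in> D \<Longrightarrow> (F has_real_derivative f s) (at s)"
    and phi_n: "\<phi>\<^sub>n \<in> V" "AE x\<in>\<Omega> in lebesgue. \<phi>\<^sub>n x \<in> D"
    and U_n: "U\<^sub>n \<in> L2 \<Omega>"
    and H_n: "H\<^sub>n = (\<lambda>x. H_fun F f B (\<phi>\<^sub>n x))"
    and form_defined: "\<And>\<psi>. \<psi> \<in> V \<Longrightarrow> (\<lambda>x. H\<^sub>n x * \<psi> x) \<in> L2 \<Omega>"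
  shows "(\<exists>\<phi>. is_solution \<Omega> V (L_form \<Omega> M \<epsilon> \<delta>t H\<^sub>n) (b_rhs M \<delta>t H\<^sub>n \<phi>\<^sub>n U\<^sub>n) \<phi> \<and>
              (\<forall>\<phi>'. is_solution \<Omega> V (L_form \<Omega> M \<epsilon> \<delta>t H\<^sub>n) (b_rhs M \<delta>t H\<^sub>n \<phi>\<^sub>n U\<^sub>n) \<phi>' \<longrightarrow>
                    (AE x\<in>\<Omega> in lebesgue. \<phi>' x = \<phi> x))) \<and>
         bilinear_form_on V (L_form \<Omega> M \<epsilon> \<delta>t H\<^sub>n) \<and>
         symmetric_form_on V (L_form \<Omega> M \<epsilon> \<delta>t H\<^sub>n) \<and>
         positive_definite_on \<Omega> V (L_form \<Omega> M \<epsilon> \<delta>t H\<^sub>n)"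
proof -
  obtain P where P: "grad_space \<Omega> P V"
    using boundary_condition grad_space_H1[OF domain(1)] grad_space_H1_per by blast
  define c where "c = sqrt (1 / (M * \<delta>t))"
  define k :: real where "k = sqrt (1 / 2)"
  have c_sq: "c > 0" "c\<^sup>2 = 1 / (M * \<delta>t)" using params by (simp_all add: c_def)
  have k: "k \<noteq> 0" "k\<^sup>2 = 1 / 2" by (simp_all add: k_def)
  interpret energy_space \<Omega> P V H\<^sub>n c \<epsilon> k
    by (intro energy_space.intro energy_space_axioms.intro P c_sq(1) params(2) form_defined)
  let ?a = "L_form \<Omega> M \<epsilon> \<delta>t H\<^sub>n"
  let ?b = "b_rhs M \<delta>t H\<^sub>n \<phi>\<^sub>n U\<^sub>n"
  have a: "?a u v = int_inner N (graph u) (graph v)" if "u \<in> V" "v \<in> V" for u v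
    using int_inner_graph[OF that] by (simp add: L_form_def sq c_sq(2) k(2))

  \<comment> \<open>The last entry is divided by \<open>k\<close> because the graph contributes another factor \<open>k\<close>.\<close>
  define G :: "real^'d \<Rightarrow> real \<times> (real^'d) \<times> real"
    where "G x = (c *\<^sub>R \<phi>\<^sub>n x, 0, k *\<^sub>R (H\<^sub>n x * \<phi>\<^sub>n x) + (- 1 / k) *\<^sub>R U\<^sub>n x)" for x
  have U: "U\<^sub>n \<in> sq_integrable N" using U_n by (simp add: sq)
  have zero: "(\<lambda>x. 0 :: real^'d) \<in> sq_integrable N" by (simp add: sq_integrable_def)
  note G_parts = sq_integrable_scale[OF V_sq(1)[OF phi_n(1)], of c] zero sq_integrable_lincomb[OF V_sq(3)[OF phi_n(1)] U, of k "- 1 / k"]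
  have G: "G \<in> sq_integrable N"
    unfolding G_def[abs_def] by (intro sq_integrable_Pair G_parts)
  have b: "L2_inner \<Omega> ?b \<psi> = int_inner N G (graph \<psi>)" if \<psi>: "\<psi> \<in> V" for \<psi>
  proof -
    note H\<phi> = V_sq(3)[OF phi_n(1)] and H\<psi> = V_sq(3)[OF \<psi>]
    note I1 = sq_integrable_inner_integrable[OF V_sq(1)[OF phi_n(1)] V_sq(1)[OF \<psi>]]
      and I2 = sq_integrable_inner_integrable[OF U H\<psi>]
      and I3 = sq_integrable_inner_integrable[OF H\<phi> H\<psi>]
    have "L2_inner \<Omega> ?b \<psi> = (\<integral>x. c\<^sup>2 * (\<phi>\<^sub>n x \<bullet> \<psi> x) - U\<^sub>n x \<bullet> (H\<^sub>n x * \<psi> x)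
        + 1 / 2 * ((H\<^sub>n x * \<phi>\<^sub>n x) \<bullet> (H\<^sub>n x * \<psi> x)) \<partial>N)"
      unfolding sq int_inner_def
      by (intro Bochner_Integration.integral_cong refl) (simp add: b_rhs_def c_sq(2) algebra_simps)
    also have "\<dots> = c\<^sup>2 * int_inner N \<phi>\<^sub>n \<psi> - int_inner N U\<^sub>n (\<lambda>x. H\<^sub>n x * \<psi> x)
        + 1 / 2 * int_inner N (\<lambda>x. H\<^sub>n x * \<phi>\<^sub>n x) (\<lambda>x. H\<^sub>n x * \<psi> x)"
      unfolding int_inner_def using I1 I2 I3 by simp
    finally have lhs: "L2_inner \<Omega> ?b \<psi> = \<dots>" .
    have "int_inner N G (graph \<psi>) = c * (c * int_inner N \<phi>\<^sub>n \<psi>)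
        + (int_inner N (\<lambda>x. 0) (\<lambda>x. \<epsilon> *\<^sub>R weak_grad \<Omega> \<psi> x)
        + k * (k * int_inner N (\<lambda>x. H\<^sub>n x * \<phi>\<^sub>n x) (\<lambda>x. H\<^sub>n x * \<psi> x) + (- 1 / k) * int_inner N U\<^sub>n (\<lambda>x. H\<^sub>n x * \<psi> x)))"
      unfolding G_def[abs_def] graph_def[abs_def]
      by (simp only: int_inner_Pair G_parts sq_integrable_Pair sq_integrable_scale V_sq[OF \<psi>] V_sq(1)[OF phi_n(1)] H\<phi> U
          int_inner_scale int_inner_lincomb)
    also have "int_inner N (\<lambda>x. 0) (\<lambda>x. \<epsilon> *\<^sub>R weak_grad \<Omega> \<psi> x) = 0" by (simp add: int_inner_def)
    also have "c * (c * int_inner N \<phi>\<^sub>n \<psi>)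
        + (0 + k * (k * int_inner N (\<lambda>x. H\<^sub>n x * \<phi>\<^sub>n x) (\<lambda>x. H\<^sub>n x * \<psi> x) + (- 1 / k) * int_inner N U\<^sub>n (\<lambda>x. H\<^sub>n x * \<psi> x)))
        = c\<^sup>2 * int_inner N \<phi>\<^sub>n \<psi> + (k\<^sup>2 * int_inner N (\<lambda>x. H\<^sub>n x * \<phi>\<^sub>n x) (\<lambda>x. H\<^sub>n x * \<psi> x) - int_inner N U\<^sub>n (\<lambda>x. H\<^sub>n x * \<psi> x))"
      using k(1) by (simp add: power2_eq_square distrib_left right_diff_distrib)
    finally show ?thesis using lhs k(2) by simp
  qed

  obtain \<phi> where \<phi>: "\<phi> \<in> V" "\<And>\<psi>. \<psi> \<in> V \<Longrightarrow> int_inner N (graph \<phi>) (graph \<psi>) = int_inner N G (graph \<psi>)"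
    by (rule ex_solution[OF G]) (use phi_n(1) in auto)
  have "is_solution \<Omega> V ?a ?b \<phi>"
    using \<phi> by (simp add: is_solution_def a b)
  moreover have "AE x\<in>\<Omega> in lebesgue. \<phi>' x = \<phi> x" if "is_solution \<Omega> V ?a ?b \<phi>'" for \<phi>'
  proof -
    have \<phi>': "\<phi>' \<in> V" "\<And>\<psi>. \<psi> \<in> V \<Longrightarrow> int_inner N (graph \<phi>') (graph \<psi>) = int_inner N G (graph \<psi>)"
      using that by (auto simp: is_solution_def a b)
    show ?thesis
      unfolding sq by (rule solution_unique[OF \<phi>(1) \<phi>'(1)]) (simp add: \<phi> \<phi>')
  qed
  moreover have "symmetric_form_on V ?a"
    by (auto simp: symmetric_form_on_def a intro: int_inner_commute)
  moreover have "bilinear_form_on V ?a"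
    unfolding bilinear_form_on_def
    by (simp add: a V_lincomb(1) int_inner_graph_lincomb int_inner_commute[of N "graph _" "graph (\<lambda>x. _ * _ x + _ * _ x)"])
       (simp add: int_inner_commute)
  moreover have "positive_definite_on \<Omega> V ?a"
    by (simp add: positive_definite_on_def a int_inner_self_nonneg int_inner_graph_eq_0_iff sq)
  ultimately show ?thesis by blast
qed

end
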